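(* Consider the cubic nonlinear Schrödinger equation $\mathrm{i}\,\partial_tu=-\Delta u+\lambda|u|^2u$, $\lambda\in\mathbb{R}$, on $\mathbb{T}^d$ (periodic boundary conditions), and on a time step $[t_n,t_n+h]$ the iterated linearisation $$u^{[0]}(t)\equiv u(t_n),\qquad\mathrm{i}\,\partial_tu^{[k+1]}(t)=-\Delta u^{[k+1]}(t)+\lambda|u^{[k]}(t)|^2u^{[k+1]}(t),\quad u^{[k+1]}(t_n)=u(t_n),\qquad k=0,1,\dots.$$ Then $$\mathcal{H}(u^{[k]})-\mathcal{H}(u)=O(h^{k+1}),\qquad k\in\mathbb{N}=\{1,2,\dots\},$$ where $\mathcal{H}$ is the Hamiltonian energy of the cubic Schrödinger equation: for each $k$ the estimate holds for $t\in[t_n,t_n+h]$ as $h\to0$, with a constant independent of $h$.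
   Context: The Hamiltonian energy is $$\mathcal{H}(v)=\frac{1}{(2\pi)^d}\int_{\mathbb{T}^d}\Bigl[|\nabla v|^2+\tfrac12\lambda|v|^4\Bigr]\mathrm{d}x=\langle-\Delta v,v\rangle+\frac{\lambda}{2}\langle|v|^2v,v\rangle,$$ with $\langle v,w\rangle=(2\pi)^{-d}\int_{\mathbb{T}^d}v\,\overline{w}\,\mathrm{d}x$. The linear equations for the iterates are understood to be solved exactly. The solution $u$ is assumed to have as much Sobolev regularity as is needed for the order statement to make sense (initial value in $H^s(\mathbb{T}^d)$ with $s$ sufficiently large). *)

theory Defs imports "HOL-Analysis.Analysis" begin

text \<open>
  Functions on the torus \<open>(\<real> / 2\<pi>\<int>)\<^sup>d\<close> are functions on \<open>real ^ 'd\<close> that are \<open>2\<pi>\<close>-periodic in every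
  coordinate; \<open>torus_mean\<close> is integration over a fundamental cell divided by \<open>(2\<pi>)\<^sup>d\<close>.
\<close>

definition torus_periodic :: "(real ^ 'd \<Rightarrow> complex) \<Rightarrow> bool" where
  "torus_periodic v \<longleftrightarrow> (\<forall>x i. v (x + (2 * pi) *\<^sub>R axis i 1) = v x)"

definition torus_cell :: "(real ^ 'd) set" where
  "torus_cell = cbox 0 (\<chi> i. 2 * pi)"

definition torus_mean :: "(real ^ 'd \<Rightarrow> 'b) \<Rightarrow> 'b::{banach, second_countable_topology}" where
  "torus_mean f = (1 / (2 * pi) ^ CARD('d)) *\<^sub>R (LINT x:torus_cell|lborel. f x)"

definition fourier_coeff :: "(real ^ 'd \<Rightarrow> complex) \<Rightarrow> int ^ 'd \<Rightarrow> complex" where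
  "fourier_coeff v m = torus_mean (\<lambda>x. v x * cis (- (\<Sum>i\<in>UNIV. of_int (m $ i) * x $ i)))"

definition sobolev_weight :: "real \<Rightarrow> int ^ 'd \<Rightarrow> real" where
  "sobolev_weight s m = (1 + (\<Sum>i\<in>UNIV. (of_int (m $ i))\<^sup>2)) powr s"

definition sobolev_space :: "real \<Rightarrow> (real ^ 'd \<Rightarrow> complex) set" where
  "sobolev_space s = {v. torus_periodic v \<and> v \<in> borel_measurable borel
     \<and> set_integrable lborel torus_cell (\<lambda>x. (cmod (v x))\<^sup>2)
     \<and> (\<lambda>m. sobolev_weight s m * (cmod (fourier_coeff v m))\<^sup>2) summable_on UNIV}"

text \<open>Meaningful on \<open>sobolev_space s\<close> only: \<open>infsum\<close> is \<open>0\<close> for families that are not summable.\<close>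

definition sobolev_norm :: "real \<Rightarrow> (real ^ 'd \<Rightarrow> complex) \<Rightarrow> real" where
  "sobolev_norm s v = sqrt (\<Sum>\<^sub>\<infinity>m. sobolev_weight s m * (cmod (fourier_coeff v m))\<^sup>2)"

definition continuous_into_sobolev ::
    "real \<Rightarrow> real set \<Rightarrow> (real \<Rightarrow> real ^ 'd \<Rightarrow> complex) \<Rightarrow> bool" where
  "continuous_into_sobolev s I w \<longleftrightarrow> (\<forall>t\<in>I. w t \<in> sobolev_space s
     \<and> ((\<lambda>\<tau>. sobolev_norm s (\<lambda>x. w \<tau> x - w t x)) \<longlongrightarrow> 0) (at t within I))"

definition partial_deriv :: "'d::finite \<Rightarrow> (real ^ 'd \<Rightarrow> complex) \<Rightarrow> real ^ 'd \<Rightarrow> complex" where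
  "partial_deriv i f x = vector_derivative (\<lambda>\<tau>. f (x + \<tau> *\<^sub>R axis i 1)) (at 0)"

definition C1_function :: "(real ^ 'd \<Rightarrow> complex) \<Rightarrow> bool" where
  "C1_function f \<longleftrightarrow> continuous_on UNIV f
     \<and> (\<forall>i. (\<forall>x. (\<lambda>\<tau>. f (x + \<tau> *\<^sub>R axis i 1)) differentiable (at 0))
          \<and> continuous_on UNIV (partial_deriv i f))"

definition C2_function :: "(real ^ 'd \<Rightarrow> complex) \<Rightarrow> bool" where
  "C2_function f \<longleftrightarrow> C1_function f \<and> (\<forall>i. C1_function (partial_deriv i f))"

definition laplacian :: "(real ^ 'd \<Rightarrow> complex) \<Rightarrow> real ^ 'd \<Rightarrow> complex" where
  "laplacian f x = (\<Sum>i\<in>UNIV. partial_deriv i (partial_deriv i f) x)"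

text \<open>
  \<open>w\<close> solves \<open>\<i> \<partial>\<^sub>t w = -\<Delta>w + \<lambda>|p|\<^sup>2w\<close> on \<open>I\<close>, classically and with values in \<open>C(I, H\<^sup>s)\<close>.  For
  \<open>s > d/2 + 2\<close> an element of \<open>H\<^sup>s\<close> has a \<open>C\<^sup>2\<close> representative, which is the one used here.
  At the end points of \<open>I\<close> the time derivative is one-sided.
\<close>

definition schroedinger_solution ::
    "real \<Rightarrow> real \<Rightarrow> real set \<Rightarrow> (real \<Rightarrow> real ^ 'd \<Rightarrow> complex) \<Rightarrow> (real \<Rightarrow> real ^ 'd \<Rightarrow> complex) \<Rightarrow> bool"
  where
  "schroedinger_solution s lam I p w \<longleftrightarrow>
     continuous_into_sobolev s I w
     \<and> (\<forall>t\<in>I. C2_function (w t))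
     \<and> (\<forall>t\<in>I. \<forall>x. \<exists>D. ((\<lambda>\<tau>. w \<tau> x) has_vector_derivative D) (at t within I)
          \<and> \<i> * D = - laplacian (w t) x + of_real (lam * (cmod (p t x))\<^sup>2) * w t x)"

definition nls_solution ::
    "real \<Rightarrow> real \<Rightarrow> real set \<Rightarrow> (real \<Rightarrow> real ^ 'd \<Rightarrow> complex) \<Rightarrow> bool" where
  "nls_solution s lam I u \<longleftrightarrow> schroedinger_solution s lam I u u"

definition iterated_linearisation ::
    "real \<Rightarrow> real \<Rightarrow> (real \<Rightarrow> real ^ 'd \<Rightarrow> complex) \<Rightarrow> real \<Rightarrow> real
      \<Rightarrow> (nat \<Rightarrow> real \<Rightarrow> real ^ 'd \<Rightarrow> complex) \<Rightarrow> bool" where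
  "iterated_linearisation s lam u tn h v \<longleftrightarrow>
     (\<forall>t\<in>{tn..tn + h}. v 0 t = u tn)
     \<and> (\<forall>j. schroedinger_solution s lam {tn..tn + h} (v j) (v (Suc j)) \<and> v (Suc j) tn = u tn)"

definition hamiltonian :: "real \<Rightarrow> (real ^ 'd \<Rightarrow> complex) \<Rightarrow> real" where
  "hamiltonian lam v = torus_mean
     (\<lambda>x. (\<Sum>i\<in>UNIV. (cmod (partial_deriv i v x))\<^sup>2) + lam / 2 * (cmod (v x)) ^ 4)"

end

theory Submission imports Defs begin

text \<open>
  Write \<open>e\<^sub>k = u\<^sup>[\<^sup>k\<^sup>] - u\<close>.  The errors solve
  \<open>\<i> \<partial>\<^sub>t e\<^sub>k\<^sub>+\<^sub>1 = -\<Delta> e\<^sub>k\<^sub>+\<^sub>1 + \<lambda>|u\<^sup>[\<^sup>k\<^sup>]|\<^sup>2 e\<^sub>k\<^sub>+\<^sub>1 + \<lambda>(|u\<^sup>[\<^sup>k\<^sup>]|\<^sup>2 - |u|\<^sup>2) u\<close> with initial value \<open>0\<close>, and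
  the last term is bounded by a multiple of \<open>e\<^sub>k\<close>.  Hence every iteration gains one power of \<open>h\<close>.
  As \<open>e\<^sub>0 = u(t\<^sub>n) - u(t) = O(h)\<close>, this gives \<open>e\<^sub>k = O(h\<^sup>k\<^sup>+\<^sup>1)\<close>, and the energy is Lipschitz on bounded
  sets of a norm that controls the function and its gradient.

  The norm used throughout is that of a weighted Wiener algebra, the sum over all
  frequencies \<open>m\<close> of \<open>\<omega>(m)\<^sup>r\<close> times the modulus of the Fourier coefficient, with
  \<open>\<omega>(m) = 2(1 + |m|\<^sup>2)\<close>.  Three properties make it
  fit the problem in every dimension.  The weight is submultiplicative, so the cubic term is estimated
  by the product of the norms (\<open>wiener_space_mult\<close>).  The free Schroedinger group multiplies each
  Fourier coefficient by a number of modulus one, so it is an isometry and Duhamel's formula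
  gives stability without any loss of derivatives (\<open>duhamel_estimate\<close>).  Finally, a factor \<open>\<omega>\<close> dominates
  one application of \<open>\<Delta>\<close>, so the norm with \<open>r = 1\<close> controls gradients uniformly, and the norm with
  \<open>r = 2\<close> controls the speed at which \<open>u\<close> moves in the norm with \<open>r = 1\<close> (\<open>nls_increment_bound\<close>).  By
  Cauchy-Schwarz, \<open>H\<^sup>s\<close> embeds into the space with \<open>r = 2\<close> as soon as \<open>s \<ge> d + 4\<close>
  (\<open>wiener_norm_le_sobolev_norm\<close>).

  The bridge between functions and coefficients is that a continuous periodic function with absolutely
  summable Fourier coefficients is the sum of its Fourier series (\<open>fourier_inversion\<close>), which
  rests on the uniqueness theorem \<open>fourier_coeff_eq_0_imp\<close>.  The estimates for the iteration
  are \<open>linear_solution_bound\<close>, which keeps all iterates in one ball independent of \<open>h\<close>,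
  and \<open>linearisation_error_step\<close>, which gains the factor \<open>h\<close>.
\<close>

section \<open>Means and characters on the torus\<close>

definition character :: "int ^ 'd \<Rightarrow> real ^ 'd \<Rightarrow> complex" where
  "character m x = cis (\<Sum>i\<in>UNIV. of_int (m $ i) * x $ i)"

lemma fourier_coeff_character: "fourier_coeff v m = torus_mean (\<lambda>x. v x * character (- m) x)"
  by (simp add: fourier_coeff_def character_def sum_negf)

lemma norm_character [simp]: "norm (character m x) = 1"
  by (simp add: character_def)

lemma character_0 [simp]: "character 0 x = 1"
  by (simp add: character_def)

lemma character_mult: "character m x * character n x = character (m + n) x"
  by (simp add: character_def cis_mult sum.distrib algebra_simps)

lemma cnj_character: "cnj (character m x) = character (- m) x"
  by (simp add: character_def cis_cnj sum_negf)

lemma character_translate: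
  "character m (x + \<tau> *\<^sub>R axis i 1) = character m x * cis (of_int (m $ i) * \<tau>)"
proof -
  have "(\<Sum>j\<in>UNIV. of_int (m $ j) * (x + \<tau> *\<^sub>R axis i 1) $ j)
      = (\<Sum>j\<in>UNIV. of_int (m $ j) * x $ j + (if j = i then of_int (m $ i) * \<tau> else 0))"
    by (intro sum.cong) (auto simp: axis_def algebra_simps)
  thus ?thesis
    by (simp add: character_def sum.distrib cis_mult)
qed

lemma torus_periodic_character: "torus_periodic (character m)"
  unfolding torus_periodic_def character_translate
  using cis_multiple_2pi[of "of_int k" for k] by (simp add: mult.commute)

lemma continuous_character [continuous_intros]: "continuous_on S (character m)"
  unfolding character_def
  by (intro continuous_intros) 

lemma content_torus_cell: "measure lborel (torus_cell :: (real ^ 'd) set) = (2 * pi) ^ CARD('d)"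
proof -
  have "measure lborel (cbox 0 (\<chi> i. 2 * pi) :: (real ^ 'd) set) = (\<Prod>i\<in>(UNIV :: 'd set). 2 * pi)"
    by (subst content_cbox_cart) (auto simp: interval_eq_empty_cart)
  thus ?thesis by (simp add: torus_cell_def)
qed

lemma set_integrable_torus_cell:
  fixes f :: "real ^ 'd \<Rightarrow> 'b::euclidean_space"
  assumes "continuous_on UNIV f"
  shows "set_integrable lborel torus_cell f"
  unfolding set_integrable_def torus_cell_def
  by (rule borel_integrable_compact) (auto intro: continuous_on_subset[OF assms])

lemma torus_mean_eq_integral:
  fixes f :: "real ^ 'd \<Rightarrow> 'b::euclidean_space"
  assumes "continuous_on UNIV f"
  shows "torus_mean f = (1 / (2 * pi) ^ CARD('d)) *\<^sub>R integral torus_cell f"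
  unfolding torus_mean_def
  using set_borel_integral_eq_integral(2)[OF set_integrable_torus_cell[OF assms]] by simp

lemma torus_mean_add:
  fixes f g :: "real ^ 'd \<Rightarrow> 'b::euclidean_space"
  assumes "continuous_on UNIV f" "continuous_on UNIV g"
  shows "torus_mean (\<lambda>x. f x + g x) = torus_mean f + torus_mean g"
  unfolding torus_mean_def
  using set_integral_add(2)[OF assms[THEN set_integrable_torus_cell]] by (simp add: scaleR_add_right)

lemma torus_mean_diff:
  fixes f g :: "real ^ 'd \<Rightarrow> 'b::euclidean_space"
  assumes "continuous_on UNIV f" "continuous_on UNIV g"
  shows "torus_mean (\<lambda>x. f x - g x) = torus_mean f - torus_mean g"
  unfolding torus_mean_def
  using set_integral_diff(2)[OF assms[THEN set_integrable_torus_cell]] by (simp add: scaleR_diff_right)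

lemma torus_mean_cmult:
  fixes f :: "real ^ 'd \<Rightarrow> complex"
  shows "torus_mean (\<lambda>x. c * f x) = c * torus_mean f"
  unfolding torus_mean_def by (simp add: scaleR_conv_of_real)

lemma torus_mean_cnj:
  fixes f :: "real ^ 'd \<Rightarrow> complex"
  shows "torus_mean (\<lambda>x. cnj (f x)) = cnj (torus_mean f)"
proof -
  have "(LINT x:torus_cell|lborel. cnj (f x)) = (LINT x|lborel. cnj (indicator torus_cell x *\<^sub>R f x))"
    unfolding set_lebesgue_integral_def by simp
  also have "\<dots> = cnj (LINT x:torus_cell|lborel. f x)"
    unfolding set_lebesgue_integral_def by (rule Bochner_Integration.integral_cnj)
  finally show ?thesis
    by (simp add: torus_mean_def)
qed

lemma norm_torus_mean_le:
  fixes f :: "real ^ 'd \<Rightarrow> 'b::euclidean_space"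
  assumes f: "continuous_on UNIV f" and B: "\<And>x. norm (f x) \<le> B"
  shows "norm (torus_mean f) \<le> B"
proof -
  have "norm (integral torus_cell f) \<le> B * measure lborel (torus_cell :: (real ^ 'd) set)"
    unfolding torus_cell_def
  proof (rule integrable_bound)
    show "0 \<le> B" using B[of 0] norm_ge_zero order_trans by blast
    show "f integrable_on cbox 0 (\<chi> i. 2 * pi)"
      by (rule integrable_continuous) (rule continuous_on_subset[OF f], simp)
  qed (use B in auto)
  thus ?thesis
    by (simp add: torus_mean_eq_integral[OF f] content_torus_cell field_simps)
qed

text \<open>
  Lebesgue measure on a Euclidean space is the image of a product measure indexed by the basis, so
  Fubini's theorem for finite products applies to it.
\<close>

lemma lborel_integral_prod:
  fixes f :: "'a::euclidean_space \<Rightarrow> real \<Rightarrow> complex"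
  assumes f: "\<And>b. b \<in> Basis \<Longrightarrow> integrable lborel (f b)"
  shows "(LINT x|lborel. (\<Prod>b\<in>Basis. f b (x \<bullet> b))) = (\<Prod>b\<in>Basis. LINT y|lborel. f b y)"
proof -
  interpret product_sigma_finite "\<lambda>_::'a. lborel :: real measure" ..
  have [measurable]: "f b \<in> borel_measurable borel" if "b \<in> Basis" for b
    using f[OF that] by auto
  show ?thesis
    by (subst lborel_eq, subst integral_distr)
       (simp_all add: f product_integral_prod[symmetric])
qed

lemma integral_cis_period:
  "(LINT y:{0..2*pi}|lborel. cis (of_int k * y)) = (if k = 0 then 2 * pi else 0)"
proof -
  have "(LINT y:{0..2*pi}|lborel. cis (of_int k * y)) = integral {0..2*pi} (\<lambda>y. cis (of_int k * y))"
    by (rule set_borel_integral_eq_integral(2))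
       (rule borel_integrable_atLeastAtMost', intro continuous_intros)
  also have "\<dots> = (if k = 0 then 2 * pi else 0)"
  proof (cases "k = 0")
    case False
    have "((\<lambda>y. exp (\<i> * of_int k * of_real y) / (\<i> * of_int k)) has_vector_derivative
        exp (\<i> * of_int k * of_real y)) (at y within {0..2*pi})" for y
      by (rule has_vector_derivative_real_field) (use False in \<open>auto intro!: derivative_eq_intros\<close>)
    hence "((\<lambda>y. cis (of_int k * y)) has_integral
        (cis (of_int k * (2*pi)) / (\<i> * of_int k) - cis (of_int k * 0) / (\<i> * of_int k))) {0..2*pi}"
      using False
      by (intro fundamental_theorem_of_calculus)
         (simp_all add: cis_conv_exp mult_ac)
    moreover have "cis (of_int k * (2 * pi)) = 1"
      using cis_multiple_2pi[of "of_int k"] by (simp add: mult_ac)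
    ultimately show ?thesis
      using False by (simp add: integral_unique)
  qed (simp add: scaleR_conv_of_real)
  finally show ?thesis .
qed

lemma prod_Basis_cart: "(\<Prod>b\<in>(Basis :: (real ^ 'd) set). g b) = (\<Prod>i\<in>(UNIV :: 'd set). g (axis i 1))"
proof -
  have "(Basis :: (real ^ 'd) set) = (\<lambda>i. axis i 1) ` UNIV"
    by (auto simp: Basis_vec_def)
  moreover have "inj (\<lambda>i::'d. axis i (1::real))"
    by (auto simp: inj_def axis_eq_axis)
  ultimately show ?thesis using prod.reindex[of "\<lambda>i::'d. axis i (1::real)" UNIV g] by (simp only: o_def)
qed

lemma cis_sum: "finite A \<Longrightarrow> cis (\<Sum>i\<in>A. f i) = (\<Prod>i\<in>A. cis (f i))"
  by (induction A rule: finite_induct) (simp_all add: cis_mult[symmetric])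

text \<open>
  A character is a product of functions of one coordinate each; its mean is therefore a product of
  one-dimensional integrals over a period.
\<close>

lemma torus_mean_character: "torus_mean (character m) = (if m = (0 :: int ^ 'd) then 1 else 0)"
proof -
  define g where "g b y = indicator {0..2*pi} y *\<^sub>R cis (of_int (m $ axis_index b) * y)"
    for b :: "real ^ 'd" and y :: real
  have int: "integrable lborel (g b)" for b
    unfolding g_def set_integrable_def[symmetric]
    by (rule borel_integrable_atLeastAtMost', intro continuous_intros)
  have "indicator torus_cell x *\<^sub>R character m x = (\<Prod>b\<in>Basis. g b (x \<bullet> b))" for x
  proof -
    have "(\<Prod>b\<in>Basis. g b (x \<bullet> b)) = (\<Prod>i\<in>UNIV. of_real (indicator {0..2*pi} (x $ i)) * cis (of_int (m $ i) * x $ i))"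
      by (simp add: prod_Basis_cart g_def axis_index_axis inner_axis scaleR_conv_of_real)
    also have "\<dots> = (\<Prod>i\<in>UNIV. of_real (indicator {0..2*pi} (x $ i))) * character m x"
      by (simp add: prod.distrib character_def cis_sum)
    also have "(\<Prod>i\<in>UNIV. of_real (indicator {0..2*pi} (x $ i))) = (indicator torus_cell x :: complex)"
      by (auto simp: torus_cell_def mem_box_cart indicator_def)
    finally show ?thesis by (simp add: scaleR_conv_of_real indicator_def)
  qed
  hence "(LINT x:torus_cell|lborel. character m x) = (\<Prod>b\<in>Basis. LINT y|lborel. g b y)"
    unfolding set_lebesgue_integral_def using lborel_integral_prod[OF int] by simp
  also have "\<dots> = (\<Prod>i\<in>UNIV. if m $ i = 0 then 2 * pi else 0)"
    unfolding prod_Basis_cart g_def axis_index_axis set_lebesgue_integral_def[symmetric]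
      integral_cis_period by simp
  also have "\<dots> = (if m = 0 then (2 * pi) ^ CARD('d) else 0)"
    by (auto simp: vec_eq_iff)
  finally show ?thesis
    by (simp add: torus_mean_def scaleR_conv_of_real)
qed

text \<open>
  Periodicity is only assumed for one period in one coordinate direction; iterating it reaches the
  whole lattice.
\<close>

lemma torus_periodic_shift:
  fixes v :: "real ^ 'd \<Rightarrow> complex" and k :: "int ^ 'd"
  assumes v: "torus_periodic v"
  shows "v (x + (\<chi> i. 2 * pi * of_int (k $ i))) = v x"
proof -
  have nat: "v (y + (2 * pi * of_nat n) *\<^sub>R axis i 1) = v y" for y i n
  proof (induction n)
    case (Suc n)
    have "y + (2 * pi * of_nat (Suc n)) *\<^sub>R axis i 1
        = (y + (2 * pi * of_nat n) *\<^sub>R axis i 1) + (2 * pi) *\<^sub>R axis i 1"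
      by (simp add: algebra_simps)
    thus ?case using v Suc unfolding torus_periodic_def by metis
  qed simp
  have int: "v (y + (2 * pi * of_int n) *\<^sub>R axis i 1) = v y" for y i n
  proof (cases "n \<ge> 0")
    case True
    thus ?thesis using nat[of y "nat n" i] by simp
  next
    case False
    thus ?thesis using nat[of "y + (2 * pi * of_int n) *\<^sub>R axis i 1" "nat (- n)" i]
      by (simp add: algebra_simps)
  qed
  have "v (x + (\<Sum>i\<in>A. (2 * pi * of_int (k $ i)) *\<^sub>R axis i 1)) = v x" if "finite A" for A
    using that
  proof (induction A rule: finite_induct)
    case (insert i A)
    have "v ((x + (\<Sum>i\<in>A. (2 * pi * of_int (k $ i)) *\<^sub>R axis i 1)) + (2 * pi * of_int (k $ i)) *\<^sub>R axis i 1) = v x"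
      unfolding int by (rule insert.IH)
    thus ?case using insert.hyps by (simp add: algebra_simps)
  qed simp
  moreover have "(\<Sum>i\<in>UNIV. (2 * pi * of_int (k $ i)) *\<^sub>R axis i 1) = (\<chi> i. 2 * pi * of_int (k $ i))"
    by (simp add: vec_eq_iff axis_def if_distrib cong: if_cong)
  ultimately show ?thesis by (metis finite_class.finite_UNIV)
qed

section \<open>Uniqueness of Fourier coefficients\<close>

text \<open>
  The torus as a product of circles, a compact subset of a Euclidean space.  This is where the
  Stone-Weierstrass theorem is applied, since ordinary polynomials pulled back along this map are
  trigonometric polynomials.
\<close>

definition torus_embed :: "real ^ 'd \<Rightarrow> complex ^ 'd" where
  "torus_embed x = (\<chi> i. cis (x $ i))"

lemma continuous_torus_embed: "continuous_on S torus_embed"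
  unfolding torus_embed_def by (intro continuous_intros)

lemma torus_embed_eqD:
  assumes "torus_periodic v" "torus_embed x = torus_embed y"
  shows "v x = v y"
proof -
  have "\<exists>n::int. x $ i = y $ i + 2 * pi * of_int n" for i
  proof -
    have "cis (x $ i) = cis (y $ i)"
      using assms(2) by (simp add: torus_embed_def vec_eq_iff)
    thus ?thesis unfolding cis_conv_exp exp_eq by (auto simp: complex_eq_iff algebra_simps)
  qed
  then obtain k where k: "\<And>i. x $ i = y $ i + 2 * pi * of_int (k i)" by metis
  have "x = y + (\<chi> i. 2 * pi * of_int ((\<chi> i. k i) $ i))"
    by (simp add: vec_eq_iff k)
  thus ?thesis using torus_periodic_shift[OF assms(1)] by metis
qed

lemma torus_embed_cell: "\<exists>y\<in>torus_cell. torus_embed y = torus_embed x"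
proof -
  define y where "y = (\<chi> i. Arg2pi (cis (x $ i)))"
  have "torus_embed y = torus_embed x"
    unfolding torus_embed_def y_def
    using Arg2pi_eq[of "cis t" for t] by (simp add: vec_eq_iff cis_conv_exp)
  moreover have "y \<in> torus_cell"
    by (auto simp: y_def torus_cell_def mem_box_cart Arg2pi_ge_0 less_imp_le[OF Arg2pi_lt_2pi])
  ultimately show ?thesis by blast
qed

inductive trig_polynomial :: "(real ^ 'd \<Rightarrow> complex) \<Rightarrow> bool" where
  monomial: "trig_polynomial (\<lambda>x. c * character m x)"
| add: "trig_polynomial f \<Longrightarrow> trig_polynomial g \<Longrightarrow> trig_polynomial (\<lambda>x. f x + g x)"

lemma trig_polynomial_const: "trig_polynomial (\<lambda>x. c)"
  using trig_polynomial.monomial[of c 0] by simp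

lemma trig_polynomial_mult:
  assumes "trig_polynomial f" "trig_polynomial g"
  shows "trig_polynomial (\<lambda>x. f x * g x)"
  using assms
proof (induction rule: trig_polynomial.induct)
  case (monomial c m)
  from monomial show ?case
  proof (induction rule: trig_polynomial.induct)
    case (monomial c' m')
    have "(\<lambda>x. c * character m x * (c' * character m' x)) = (\<lambda>x. (c * c') * character (m + m') x)"
      by (simp add: character_mult[symmetric] mult_ac)
    thus ?case by (simp add: trig_polynomial.monomial)
  next
    case (add f g)
    thus ?case by (simp add: distrib_left trig_polynomial.add)
  qed
next
  case (add f g)
  thus ?case by (simp add: distrib_right trig_polynomial.add)
qed

lemma trig_polynomial_sum:
  assumes "finite A" "\<And>a. a \<in> A \<Longrightarrow> trig_polynomial (f a)"
  shows "trig_polynomial (\<lambda>x. \<Sum>a\<in>A. f a x)"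
  using assms by (induction A rule: finite_induct) (auto intro: trig_polynomial.add trig_polynomial_const)

lemma trig_polynomial_cos_sin:
  fixes i :: "'d::finite"
  shows "trig_polynomial (\<lambda>x. of_real (cos (x $ i)))" "trig_polynomial (\<lambda>x. of_real (sin (x $ i)))"
proof -
  have c: "character (axis i 1) x = cis (x $ i)" "character (- axis i 1) x = cis (- (x $ i))" for x :: "real ^ 'd"
  proof -
    have "(\<Sum>j\<in>UNIV. of_int (axis i 1 $ j) * x $ j) = (\<Sum>j\<in>UNIV. if j = i then x $ j else 0)"
      by (intro sum.cong) (auto simp: axis_def)
    thus "character (axis i 1) x = cis (x $ i)" "character (- axis i 1) x = cis (- (x $ i))"
      by (simp_all add: character_def sum_negf)
  qed
  have "(\<lambda>x. of_real (cos (x $ i))) = (\<lambda>x. 1/2 * character (axis i 1) x + 1/2 * character (- axis i 1) x)"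
    by (auto simp: c complex_eq_iff)
  thus "trig_polynomial (\<lambda>x. of_real (cos (x $ i)))"
    by (simp only:) (rule trig_polynomial.add; rule trig_polynomial.monomial)
  have "(\<lambda>x. of_real (sin (x $ i))) = (\<lambda>x. (- \<i>/2) * character (axis i 1) x + (\<i>/2) * character (- axis i 1) x)"
    by (auto simp: c complex_eq_iff)
  thus "trig_polynomial (\<lambda>x. of_real (sin (x $ i)))"
    by (simp only:) (rule trig_polynomial.add; rule trig_polynomial.monomial)
qed

text \<open>
  A real-linear form on the ambient space becomes a combination of the cosines and sines of the
  coordinates, and trigonometric polynomials form an algebra.
\<close>

lemma trig_polynomial_embed:
  fixes g :: "complex ^ 'd \<Rightarrow> real"
  assumes "real_polynomial_function g"
  shows "trig_polynomial (\<lambda>x. of_real (g (torus_embed x)))"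
  using assms
proof (induction rule: real_polynomial_function.induct)
  case (linear f)
  interpret f: bounded_linear f by fact
  have expand: "f z = (\<Sum>i\<in>UNIV. Re (z $ i) * f (axis i 1) + Im (z $ i) * f (axis i \<i>))" for z
  proof -
    have "z = (\<Sum>i\<in>UNIV. axis i (z $ i))"
      by (simp add: vec_eq_iff axis_def if_distrib cong: if_cong)
    also have "\<dots> = (\<Sum>i\<in>UNIV. Re (z $ i) *\<^sub>R axis i 1 + Im (z $ i) *\<^sub>R axis i \<i>)"
      by (intro sum.cong refl) (simp add: vec_eq_iff axis_def complex_eq_iff)
    also have "f \<dots> = (\<Sum>i\<in>UNIV. Re (z $ i) * f (axis i 1) + Im (z $ i) * f (axis i \<i>))"
      by (simp add: f.sum f.add f.scaleR)
    finally show ?thesis .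
  qed
  have "(\<lambda>x. of_real (f (torus_embed x))) = (\<lambda>x. \<Sum>i\<in>UNIV.
      of_real (cos (x $ i)) * of_real (f (axis i 1)) + of_real (sin (x $ i)) * of_real (f (axis i \<i>)) :: complex)"
    by (subst expand) (simp add: torus_embed_def)
  thus ?case
    by (simp only:) (intro trig_polynomial_sum trig_polynomial.add trig_polynomial_mult
        trig_polynomial_cos_sin trig_polynomial_const finite)
next
  case (const c)
  show ?case by (rule trig_polynomial_const)
next
  case (add f g)
  thus ?case by (simp add: trig_polynomial.add)
next
  case (mult f g)
  thus ?case by (simp add: trig_polynomial_mult)
qed

lemma continuous_trig_polynomial: "trig_polynomial f \<Longrightarrow> continuous_on S f"
  by (induction rule: trig_polynomial.induct) (auto intro!: continuous_intros)

lemma torus_mean_trig_polynomial_eq_0: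
  assumes v: "continuous_on UNIV v" and 0: "\<And>m. fourier_coeff v m = 0" and f: "trig_polynomial f"
  shows "torus_mean (\<lambda>x. v x * f x) = 0"
  using f
proof (induction rule: trig_polynomial.induct)
  case (monomial c m)
  have "torus_mean (\<lambda>x. c * (v x * character m x)) = 0"
    using 0[of "- m"] by (simp add: torus_mean_cmult fourier_coeff_character)
  thus ?case by (simp add: mult_ac)
next
  case (add f g)
  thus ?case
    by (simp add: distrib_left torus_mean_add continuous_on_mult[OF v] continuous_trig_polynomial)
qed

text \<open>
  A periodic function factors through the embedding of the torus.  The factor is continuous because
  the embedding maps the compact cell onto its image, so that it is a closed map.  Its real and
  imaginary parts are then approximated by polynomials.
\<close>

lemma trig_polynomial_approximation:
  fixes v :: "real ^ 'd \<Rightarrow> complex"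
  assumes per: "torus_periodic v" and v: "continuous_on UNIV v" and e: "e > 0"
  obtains f where "trig_polynomial f" "\<And>x. norm (v x - f x) < e"
proof -
  define K where "K = torus_embed ` (torus_cell :: (real ^ 'd) set)"
  have cell: "compact (torus_cell :: (real ^ 'd) set)" by (simp add: torus_cell_def)
  have K: "compact K"
    unfolding K_def by (rule compact_continuous_image[OF continuous_torus_embed cell])
  define F where "F z = v (SOME x. torus_embed x = z)" for z
  have F: "F (torus_embed x) = v x" for x
    unfolding F_def by (rule torus_embed_eqD[OF per]) (rule someI, rule refl)
  \<comment> \<open>the preimage of a closed set is the image of a compact subset of the cell\<close>
  have contF: "continuous_on K F"
    unfolding continuous_on_closed_vimage[OF compact_imp_closed[OF K]]
  proof (intro allI impI)
    fix B :: "complex set" assume B: "closed B"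
    have "F -` B \<inter> K = torus_embed ` (v -` B \<inter> torus_cell)"
      by (auto simp: K_def F)
    moreover have "closed (v -` B)"
      using v B by (simp add: continuous_on_closed_vimage)
    hence "compact (v -` B \<inter> torus_cell)" using cell by (rule closed_Int_compact)
    ultimately show "closed (F -` B \<inter> K)"
      using compact_continuous_image[OF continuous_torus_embed] compact_imp_closed by metis
  qed
  obtain g where g: "real_polynomial_function g" "\<And>z. z \<in> K \<Longrightarrow> \<bar>Re (F z) - g z\<bar> < e / 2"
    using Stone_Weierstrass_real_polynomial_function[OF K, of "\<lambda>z. Re (F z)" "e / 2"] e continuous_on_Re[OF contF]
    by auto
  obtain h where h: "real_polynomial_function h" "\<And>z. z \<in> K \<Longrightarrow> \<bar>Im (F z) - h z\<bar> < e / 2"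
    using Stone_Weierstrass_real_polynomial_function[OF K, of "\<lambda>z. Im (F z)" "e / 2"] e continuous_on_Im[OF contF]
    by auto
  define f where "f x = of_real (g (torus_embed x)) + \<i> * of_real (h (torus_embed x))" for x
  have "trig_polynomial f"
    unfolding f_def
    by (intro trig_polynomial.add trig_polynomial_mult trig_polynomial_const trig_polynomial_embed g h)
  moreover have "norm (v x - f x) < e" for x
  proof -
    have z: "torus_embed x \<in> K" using torus_embed_cell[of x] unfolding K_def by (metis imageI)
    have "norm (v x - f x) \<le> \<bar>Re (v x - f x)\<bar> + \<bar>Im (v x - f x)\<bar>" by (rule cmod_le)
    also have "\<dots> < e / 2 + e / 2"
      using g(2)[OF z] h(2)[OF z] unfolding F by (intro add_strict_mono) (simp_all add: f_def)
    finally show ?thesis by simp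
  qed
  ultimately show ?thesis using that by blast
qed

lemma bounded_torus_periodic:
  fixes v :: "real ^ 'd \<Rightarrow> complex"
  assumes per: "torus_periodic v" and v: "continuous_on UNIV v"
  obtains B where "\<And>x. norm (v x) \<le> B" "B > 0"
proof -
  have "compact (v ` torus_cell)"
    by (rule compact_continuous_image[OF continuous_on_subset[OF v]]) (auto simp: torus_cell_def)
  then obtain B where B: "B > 0" "\<And>x. x \<in> torus_cell \<Longrightarrow> norm (v x) \<le> B"
    using bounded_pos[of "v ` torus_cell"] compact_imp_bounded by auto
  show ?thesis
  proof
    fix x :: "real ^ 'd"
    obtain y where "y \<in> torus_cell" "torus_embed y = torus_embed x" using torus_embed_cell by blast
    thus "norm (v x) \<le> B" using torus_embed_eqD[OF per] B by metis
  qed fact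
qed

text \<open>
  A function with vanishing Fourier coefficients is orthogonal to all trigonometric polynomials,
  hence by density to itself; so the mean of \<open>|v|\<^sup>2\<close> vanishes, and \<open>v = 0\<close> by continuity.
\<close>

lemma fourier_coeff_eq_0_imp:
  fixes v :: "real ^ 'd \<Rightarrow> complex"
  assumes per: "torus_periodic v" and v: "continuous_on UNIV v" and 0: "\<And>m. fourier_coeff v m = 0"
  shows "v x = 0"
proof -
  obtain B where B: "\<And>x. norm (v x) \<le> B" "B > 0" using bounded_torus_periodic[OF per v] by metis
  have v': "continuous_on UNIV (\<lambda>x. cnj (v x))" using v by (intro continuous_intros)
  have per': "torus_periodic (\<lambda>x. cnj (v x))" using per by (simp add: torus_periodic_def)
  have "norm (torus_mean (\<lambda>x. v x * cnj (v x))) \<le> \<epsilon>" if "\<epsilon> > 0" for \<epsilon>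
  proof -
    obtain f where f: "trig_polynomial f" "\<And>x. norm (cnj (v x) - f x) < \<epsilon> / B"
      using trig_polynomial_approximation[OF per' v', of "\<epsilon> / B"] \<open>\<epsilon> > 0\<close> B by auto
    have "torus_mean (\<lambda>x. v x * cnj (v x)) = torus_mean (\<lambda>x. v x * f x + v x * (cnj (v x) - f x))"
      by (simp add: algebra_simps)
    also have "\<dots> = torus_mean (\<lambda>x. v x * (cnj (v x) - f x))"
      using v v' continuous_trig_polynomial[OF f(1)] torus_mean_trig_polynomial_eq_0[OF v 0 f(1)]
      by (subst torus_mean_add) (auto intro!: continuous_intros)
    also have "norm \<dots> \<le> B * (\<epsilon> / B)"
    proof (rule norm_torus_mean_le)
      show "norm (v x * (cnj (v x) - f x)) \<le> B * (\<epsilon> / B)" for x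
        unfolding norm_mult using B f(2)[of x] by (intro mult_mono) auto
    qed (use v v' continuous_trig_polynomial[OF f(1)] in \<open>auto intro!: continuous_intros\<close>)
    finally show ?thesis using B by simp
  qed
  hence "norm (torus_mean (\<lambda>x. v x * cnj (v x))) \<le> 0" by (rule field_le_epsilon) simp
  hence *: "torus_mean (\<lambda>x. v x * cnj (v x)) = 0" by simp
  have cont: "continuous_on S (\<lambda>x. (norm (v x))\<^sup>2)" for S
    using continuous_on_subset[OF v] by (intro continuous_intros) auto
  have "integral torus_cell (\<lambda>x. complex_of_real ((norm (v x))\<^sup>2)) = 0"
    using * v v' unfolding complex_norm_square
    by (subst (asm) torus_mean_eq_integral) (auto intro!: continuous_intros)
  moreover have "((\<lambda>x. (norm (v x))\<^sup>2) has_integral integral torus_cell (\<lambda>x. (norm (v x))\<^sup>2)) torus_cell"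
    unfolding torus_cell_def by (intro integrable_integral integrable_continuous cont)
  hence "((\<lambda>x. complex_of_real ((norm (v x))\<^sup>2)) has_integral of_real (integral torus_cell (\<lambda>x. (norm (v x))\<^sup>2))) torus_cell"
    by (rule has_integral_of_real)
  ultimately have I0: "((\<lambda>x. (norm (v x))\<^sup>2) has_integral 0) torus_cell"
    using \<open>((\<lambda>x. (norm (v x))\<^sup>2) has_integral _) _\<close> by (metis integral_unique of_real_eq_0_iff)
  have zero: "v y = 0" if "y \<in> torus_cell" for y
  proof -
    have "(norm (v y))\<^sup>2 = 0"
      using I0 that unfolding torus_cell_def
      by (intro has_integral_0_cbox_imp_0[of 0 "\<chi> i. 2 * pi" "\<lambda>x. (norm (v x))\<^sup>2"] cont)
         (auto simp: interval_eq_empty_cart not_le)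
    thus ?thesis by simp
  qed
  obtain y where "y \<in> torus_cell" "torus_embed y = torus_embed x" using torus_embed_cell by blast
  thus ?thesis using torus_embed_eqD[OF per] zero by metis
qed

section \<open>Absolutely convergent Fourier series\<close>

lemma torus_mean_infsum:
  fixes f :: "'a \<Rightarrow> real ^ 'd \<Rightarrow> complex"
  assumes M: "M summable_on UNIV" and le: "\<And>n x. norm (f n x) \<le> M n"
    and f: "\<And>n. continuous_on UNIV (f n)"
  shows "continuous_on UNIV (\<lambda>x. \<Sum>\<^sub>\<infinity>n. f n x)"
    and "((\<lambda>n. torus_mean (f n)) has_sum torus_mean (\<lambda>x. \<Sum>\<^sub>\<infinity>n. f n x)) UNIV"
proof -
  have u: "uniform_limit UNIV (\<lambda>F x. \<Sum>n\<in>F. f n x) (\<lambda>x. \<Sum>\<^sub>\<infinity>n. f n x) (finite_subsets_at_top UNIV)"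
    by (rule Weierstrass_m_test_general[OF _ M]) (rule le)
  have fin: "continuous_on UNIV (\<lambda>x. \<Sum>n\<in>F. f n x)" for F
    using f by (intro continuous_intros) 
  show cont: "continuous_on UNIV (\<lambda>x. \<Sum>\<^sub>\<infinity>n. f n x)"
    by (rule uniform_limit_theorem[OF _ u]) (auto simp: fin)
  have sum: "torus_mean (\<lambda>x. \<Sum>n\<in>F. f n x) = (\<Sum>n\<in>F. torus_mean (f n))" if "finite F" for F
    using that
  proof (induction F rule: finite_induct)
    case (insert n F)
    thus ?case by (simp add: torus_mean_add[OF f fin])
  qed (simp add: torus_mean_def)
  show "((\<lambda>n. torus_mean (f n)) has_sum torus_mean (\<lambda>x. \<Sum>\<^sub>\<infinity>n. f n x)) UNIV"
    unfolding has_sum_def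
  proof (rule tendstoI)
    fix e :: real assume "e > 0"
    have "\<forall>\<^sub>F F in finite_subsets_at_top UNIV. finite (F :: 'a set)"
      by (rule eventually_finite_subsets_at_top_weakI)
    moreover have "\<forall>\<^sub>F F in finite_subsets_at_top UNIV. \<forall>x\<in>UNIV. dist (\<Sum>n\<in>F. f n x) (\<Sum>\<^sub>\<infinity>n. f n x) < e / 2"
      using \<open>e > 0\<close> by (intro uniform_limitD[OF u]) simp
    ultimately show "\<forall>\<^sub>F F in finite_subsets_at_top UNIV.
        dist (\<Sum>n\<in>F. torus_mean (f n)) (torus_mean (\<lambda>x. \<Sum>\<^sub>\<infinity>n. f n x)) < e"
    proof eventually_elim
      case (elim F)
      have "norm (torus_mean (\<lambda>x. (\<Sum>n\<in>F. f n x) - (\<Sum>\<^sub>\<infinity>n. f n x))) \<le> e / 2"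
        using elim by (intro norm_torus_mean_le continuous_on_diff fin cont) (auto simp: dist_norm less_imp_le)
      thus ?case using \<open>e > 0\<close> elim by (simp add: torus_mean_diff[OF fin cont] sum dist_norm)
    qed
  qed
qed

definition fourier_series :: "(int ^ 'd \<Rightarrow> complex) \<Rightarrow> real ^ 'd \<Rightarrow> complex" where
  "fourier_series a x = (\<Sum>\<^sub>\<infinity>m. a m * character m x)"

lemma summable_fourier_series:
  fixes a :: "int ^ 'd \<Rightarrow> complex"
  assumes "(\<lambda>m. norm (a m)) summable_on UNIV"
  shows "(\<lambda>m. a m * character m x) summable_on UNIV"
  by (rule abs_summable_summable) (simp add: norm_mult assms)

lemma fourier_coeff_diff:
  assumes "continuous_on UNIV v" "continuous_on UNIV w"
  shows "fourier_coeff (\<lambda>x. v x - w x) m = fourier_coeff v m - fourier_coeff w m"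
  unfolding fourier_coeff_character left_diff_distrib
  by (rule torus_mean_diff; intro continuous_intros assms)

lemma fourier_coeff_add:
  assumes "continuous_on UNIV v" "continuous_on UNIV w"
  shows "fourier_coeff (\<lambda>x. v x + w x) m = fourier_coeff v m + fourier_coeff w m"
  unfolding fourier_coeff_character distrib_right
  by (rule torus_mean_add; intro continuous_intros assms)

lemma fourier_coeff_cmult: "fourier_coeff (\<lambda>x. c * v x) m = c * fourier_coeff v m"
  unfolding fourier_coeff_character mult.assoc by (rule torus_mean_cmult)

lemma fourier_coeff_cnj: "fourier_coeff (\<lambda>x. cnj (v x)) m = cnj (fourier_coeff v (- m))"
proof -
  have "(\<lambda>x. cnj (v x) * character (- m) x) = (\<lambda>x. cnj (v x * character m x))"
    by (simp add: cnj_character)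
  thus ?thesis by (simp add: fourier_coeff_character torus_mean_cnj del: complex_cnj_mult)
qed

lemma fourier_coeff_mult_character:
  "fourier_coeff (\<lambda>x. character n x * w x) m = fourier_coeff w (m - n)"
proof -
  have "character n x * w x * character (- m) x = w x * character (- (m - n)) x" for x
    using character_mult[of n x "- m"] by (simp add: mult_ac)
  thus ?thesis by (simp only: fourier_coeff_character)
qed

text \<open>
  The convolution formula for the coefficients of a product.  Only one factor has to be an absolutely
  convergent series, so the case \<open>w = 1\<close> yields the coefficients of the series itself.
\<close>

lemma fourier_coeff_fourier_series_mult:
  fixes a :: "int ^ 'd \<Rightarrow> complex"
  assumes a: "(\<lambda>m. norm (a m)) summable_on UNIV" and w: "torus_periodic w" "continuous_on UNIV w"
  shows "((\<lambda>n. a n * fourier_coeff w (m - n)) has_sum fourier_coeff (\<lambda>x. fourier_series a x * w x) m) UNIV"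
proof -
  obtain B where B: "\<And>x. norm (w x) \<le> B" "B > 0" using bounded_torus_periodic[OF w] by metis
  define f where "f n x = a n * (character n x * w x * character (- m) x)" for n x
  have "((\<lambda>n. torus_mean (f n)) has_sum torus_mean (\<lambda>x. \<Sum>\<^sub>\<infinity>n. f n x)) UNIV"
  proof (rule torus_mean_infsum)
    show "(\<lambda>n. norm (a n) * B) summable_on UNIV" using a by (rule summable_on_cmult_left)
    show "norm (f n x) \<le> norm (a n) * B" for n x
      using B(1)[of x] by (auto simp: f_def norm_mult intro!: mult_left_mono)
    show "continuous_on UNIV (f n)" for n
      unfolding f_def using w by (intro continuous_intros)
  qed
  moreover have "torus_mean (f n) = a n * fourier_coeff w (m - n)" for n
    using fourier_coeff_mult_character[of n w m]
    by (simp add: f_def[abs_def] torus_mean_cmult fourier_coeff_character)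
  moreover have "(\<Sum>\<^sub>\<infinity>n. f n x) = fourier_series a x * w x * character (- m) x" for x
    unfolding f_def fourier_series_def mult.assoc[symmetric] by (simp add: infsum_cmult_left')
  ultimately show ?thesis
    by (simp add: fourier_coeff_character)
qed

lemma continuous_fourier_series:
  fixes a :: "int ^ 'd \<Rightarrow> complex"
  assumes a: "(\<lambda>m. norm (a m)) summable_on UNIV"
  shows "continuous_on S (fourier_series a)"
proof -
  have "continuous_on UNIV (\<lambda>x. \<Sum>\<^sub>\<infinity>m. a m * character m x)"
    by (rule torus_mean_infsum(1)[OF a]) (auto simp: norm_mult intro!: continuous_intros)
  thus ?thesis unfolding fourier_series_def[abs_def] by (rule continuous_on_subset) simp
qed

lemma torus_periodic_fourier_series: "torus_periodic (fourier_series a)"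
  unfolding torus_periodic_def fourier_series_def
  by (intro allI infsum_cong) (simp add: torus_periodic_character[unfolded torus_periodic_def, rule_format])

lemma torus_periodic_1: "torus_periodic (\<lambda>_. 1)"
  by (simp add: torus_periodic_def)

lemma fourier_coeff_1: "fourier_coeff (\<lambda>x. 1) m = (if m = 0 then 1 else 0)"
  using torus_mean_character[of "- m"] by (simp add: fourier_coeff_character)

lemma fourier_coeff_fourier_series:
  fixes a :: "int ^ 'd \<Rightarrow> complex"
  assumes a: "(\<lambda>m. norm (a m)) summable_on UNIV"
  shows "fourier_coeff (fourier_series a) m = a m"
proof -
  have "((\<lambda>n. a n * fourier_coeff (\<lambda>x. 1) (m - n)) has_sum fourier_coeff (fourier_series a) m) UNIV"
    using fourier_coeff_fourier_series_mult[OF a torus_periodic_1] by simp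
  moreover have "((\<lambda>n. a n * fourier_coeff (\<lambda>x. 1) (m - n)) has_sum a m) UNIV"
    by (rule has_sum_finite_neutralI[of "{m}"]) (auto simp: fourier_coeff_1)
  ultimately show ?thesis by (rule has_sum_unique)
qed

lemma fourier_inversion:
  fixes v :: "real ^ 'd \<Rightarrow> complex"
  assumes v: "torus_periodic v" "continuous_on UNIV v"
    and a: "(\<lambda>m. norm (fourier_coeff v m)) summable_on UNIV"
  shows "v x = fourier_series (fourier_coeff v) x"
proof -
  have "v x - fourier_series (fourier_coeff v) x = 0"
  proof (rule fourier_coeff_eq_0_imp)
    show "torus_periodic (\<lambda>x. v x - fourier_series (fourier_coeff v) x)"
      using v torus_periodic_fourier_series[of "fourier_coeff v"] by (simp add: torus_periodic_def)
    show "continuous_on UNIV (\<lambda>x. v x - fourier_series (fourier_coeff v) x)"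
      using v continuous_fourier_series[OF a] by (intro continuous_intros)
    show "fourier_coeff (\<lambda>x. v x - fourier_series (fourier_coeff v) x) m = 0" for m
      using v continuous_fourier_series[OF a] fourier_coeff_fourier_series[OF a]
      by (simp add: fourier_coeff_diff)
  qed
  thus ?thesis by simp
qed

section \<open>The weighted Wiener algebra\<close>

text \<open>
  The eigenvalue of \<open>-\<Delta>\<close> on the character of frequency \<open>m\<close>.
\<close>

definition freq_sq :: "int ^ 'd \<Rightarrow> real" where
  "freq_sq m = (\<Sum>i\<in>UNIV. (of_int (m $ i))\<^sup>2)"

text \<open>
  The factor \<open>2\<close> makes the weight submultiplicative.
\<close>

definition freq_weight :: "int ^ 'd \<Rightarrow> real" where
  "freq_weight m = 2 * (1 + freq_sq m)"

lemma freq_sq_nonneg: "freq_sq m \<ge> 0"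
  by (simp add: freq_sq_def sum_nonneg)

lemma freq_weight_ge_1: "freq_weight m \<ge> 1"
  using freq_sq_nonneg[of m] by (simp add: freq_weight_def)

lemma freq_weight_nonneg [simp]: "freq_weight m \<ge> 0"
  using freq_weight_ge_1[of m] by simp

lemma freq_sq_le_weight: "freq_sq m \<le> freq_weight m"
  using freq_sq_nonneg[of m] by (simp add: freq_weight_def)

lemma freq_weight_uminus [simp]: "freq_weight (- m) = freq_weight m"
  by (simp add: freq_weight_def freq_sq_def)

lemma freq_weight_add_le: "freq_weight (m + n) \<le> freq_weight m * freq_weight n"
proof -
  have "freq_sq (m + n) \<le> (\<Sum>i\<in>UNIV. 2 * (of_int (m $ i))\<^sup>2 + 2 * (of_int (n $ i))\<^sup>2)"
    unfolding freq_sq_def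
  proof (rule sum_mono)
    fix i
    have "0 \<le> (real_of_int (m $ i) - of_int (n $ i))\<^sup>2" by simp
    thus "(real_of_int ((m + n) $ i))\<^sup>2 \<le> 2 * (of_int (m $ i))\<^sup>2 + 2 * (of_int (n $ i))\<^sup>2"
      by (simp add: power2_eq_square algebra_simps)
  qed
  also have "\<dots> = 2 * freq_sq m + 2 * freq_sq n"
    by (simp add: freq_sq_def sum.distrib sum_distrib_left)
  finally have "freq_weight (m + n) \<le> 2 + 4 * freq_sq m + 4 * freq_sq n"
    by (simp add: freq_weight_def)
  also have "\<dots> \<le> freq_weight m * freq_weight n"
    using freq_sq_nonneg[of m] freq_sq_nonneg[of n] by (simp add: freq_weight_def algebra_simps)
  finally show ?thesis .
qed

lemma abs_freq_le_weight: "\<bar>real_of_int (m $ i)\<bar> \<le> freq_weight m"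
proof -
  have "(real_of_int (m $ i))\<^sup>2 \<le> freq_sq m"
    unfolding freq_sq_def by (rule member_le_sum) auto
  moreover have "2 * \<bar>real_of_int (m $ i)\<bar> \<le> 1 + (real_of_int (m $ i))\<^sup>2"
    using zero_le_power2[of "\<bar>real_of_int (m $ i)\<bar> - 1"] by (simp add: power2_diff)
  ultimately show ?thesis by (simp add: freq_weight_def)
qed

lemma square_freq_le_weight: "(real_of_int (m $ i))\<^sup>2 \<le> freq_weight m"
proof -
  have "(real_of_int (m $ i))\<^sup>2 \<le> freq_sq m"
    unfolding freq_sq_def by (rule member_le_sum) auto
  thus ?thesis using freq_sq_le_weight[of m] by simp
qed

text \<open>
  Meaningful on \<open>wiener_space r\<close> only, because an infinite sum that does not converge has the value
  \<open>0\<close>.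
\<close>

definition wiener_norm :: "nat \<Rightarrow> (real ^ 'd \<Rightarrow> complex) \<Rightarrow> real" where
  "wiener_norm r v = (\<Sum>\<^sub>\<infinity>m. freq_weight m ^ r * norm (fourier_coeff v m))"

definition wiener_space :: "nat \<Rightarrow> (real ^ 'd \<Rightarrow> complex) set" where
  "wiener_space r = {v. torus_periodic v \<and> continuous_on UNIV v
     \<and> (\<lambda>m. freq_weight m ^ r * norm (fourier_coeff v m)) summable_on UNIV}"

lemma wiener_spaceD:
  assumes "v \<in> wiener_space r"
  shows "torus_periodic v" "continuous_on UNIV v"
    "(\<lambda>m. freq_weight m ^ r * norm (fourier_coeff v m)) summable_on UNIV"
  using assms by (auto simp: wiener_space_def)

lemma wiener_norm_nonneg: "wiener_norm r v \<ge> 0"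
  unfolding wiener_norm_def by (rule infsum_nonneg) simp

text \<open>
  Membership and a norm bound at once, from a summable majorant of the weighted coefficients.
\<close>

lemma wiener_norm_leI:
  assumes le: "\<And>m. freq_weight m ^ r * norm (fourier_coeff v m) \<le> g m" and g: "(g has_sum S) UNIV"
    and v: "torus_periodic v" "continuous_on UNIV v"
  shows "v \<in> wiener_space r" "wiener_norm r v \<le> S"
proof -
  have s: "(\<lambda>m. freq_weight m ^ r * norm (fourier_coeff v m)) summable_on UNIV"
    by (rule summable_on_comparison_test[OF has_sum_imp_summable[OF g]]) (auto simp: le)
  thus "v \<in> wiener_space r" using v by (simp add: wiener_space_def)
  show "wiener_norm r v \<le> S"
    unfolding wiener_norm_def infsumI[OF g, symmetric]
    by (rule infsum_mono[OF s has_sum_imp_summable[OF g]]) (rule le)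
qed

lemma has_sum_wiener_norm:
  assumes "v \<in> wiener_space r"
  shows "((\<lambda>m. freq_weight m ^ r * norm (fourier_coeff v m)) has_sum wiener_norm r v) UNIV"
  unfolding wiener_norm_def using wiener_spaceD(3)[OF assms] by simp

lemma wiener_space_mono:
  assumes v: "v \<in> wiener_space r" and "q \<le> r"
  shows "v \<in> wiener_space q" "wiener_norm q v \<le> wiener_norm r v"
proof -
  have le: "freq_weight m ^ q * norm (fourier_coeff v m) \<le> freq_weight m ^ r * norm (fourier_coeff v m)" for m
    using \<open>q \<le> r\<close> freq_weight_ge_1 by (intro mult_right_mono power_increasing) auto
  show "v \<in> wiener_space q" "wiener_norm q v \<le> wiener_norm r v"
    by (rule wiener_norm_leI[OF le has_sum_wiener_norm[OF v] wiener_spaceD(1,2)[OF v]])+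
qed

lemma wiener_space_summable:
  assumes "v \<in> wiener_space r"
  shows "(\<lambda>m. norm (fourier_coeff v m)) summable_on UNIV"
  using wiener_spaceD(3)[OF wiener_space_mono(1)[OF assms, of 0]] by simp

lemma wiener_space_inversion:
  assumes "v \<in> wiener_space r"
  shows "v = fourier_series (fourier_coeff v)"
  using fourier_inversion[OF wiener_spaceD(1,2)[OF assms] wiener_space_summable[OF assms]] by blast

lemma wiener_space_eqI:
  assumes "v \<in> wiener_space r" "w \<in> wiener_space q" "\<And>m. fourier_coeff v m = fourier_coeff w m"
  shows "v = w"
  using wiener_space_inversion[OF assms(1)] wiener_space_inversion[OF assms(2)] assms(3)
  by (metis ext)

lemma norm_le_wiener_norm:
  assumes v: "v \<in> wiener_space r"
  shows "norm (v x) \<le> wiener_norm r v"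
proof -
  have "norm (\<Sum>\<^sub>\<infinity>m. fourier_coeff v m * character m x) \<le> wiener_norm 0 v"
    by (rule norm_infsum_le[OF has_sum_infsum[OF summable_fourier_series[OF wiener_space_summable[OF v]]]
          has_sum_wiener_norm[OF wiener_space_mono(1)[OF v]]])
       (auto simp: norm_mult)
  also have "\<dots> \<le> wiener_norm r v" by (rule wiener_space_mono(2)[OF v]) simp
  finally show ?thesis
    using wiener_space_inversion[OF v] by (simp add: fourier_series_def fun_eq_iff)
qed

lemma wiener_space_diff:
  assumes v: "v \<in> wiener_space r" and w: "w \<in> wiener_space r"
  shows "(\<lambda>x. v x - w x) \<in> wiener_space r"
    "wiener_norm r (\<lambda>x. v x - w x) \<le> wiener_norm r v + wiener_norm r w"
proof -
  have le: "freq_weight m ^ r * norm (fourier_coeff (\<lambda>x. v x - w x) m)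
      \<le> freq_weight m ^ r * norm (fourier_coeff v m) + freq_weight m ^ r * norm (fourier_coeff w m)" for m
    using wiener_spaceD(2)[OF v] wiener_spaceD(2)[OF w]
    by (simp add: fourier_coeff_diff distrib_left[symmetric] mult_left_mono norm_triangle_ineq4)
  have per: "torus_periodic (\<lambda>x. v x - w x)"
    using wiener_spaceD(1)[OF v] wiener_spaceD(1)[OF w] by (simp add: torus_periodic_def)
  show "(\<lambda>x. v x - w x) \<in> wiener_space r" "wiener_norm r (\<lambda>x. v x - w x) \<le> wiener_norm r v + wiener_norm r w"
    by (rule wiener_norm_leI[OF le has_sum_add[OF has_sum_wiener_norm[OF v] has_sum_wiener_norm[OF w]] per];
        intro continuous_intros wiener_spaceD(2)[OF v] wiener_spaceD(2)[OF w])+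
qed

lemma wiener_space_add:
  assumes v: "v \<in> wiener_space r" and w: "w \<in> wiener_space r"
  shows "(\<lambda>x. v x + w x) \<in> wiener_space r"
    "wiener_norm r (\<lambda>x. v x + w x) \<le> wiener_norm r v + wiener_norm r w"
proof -
  have le: "freq_weight m ^ r * norm (fourier_coeff (\<lambda>x. v x + w x) m)
      \<le> freq_weight m ^ r * norm (fourier_coeff v m) + freq_weight m ^ r * norm (fourier_coeff w m)" for m
    using wiener_spaceD(2)[OF v] wiener_spaceD(2)[OF w]
    by (simp add: fourier_coeff_add distrib_left[symmetric] mult_left_mono norm_triangle_ineq)
  have per: "torus_periodic (\<lambda>x. v x + w x)"
    using wiener_spaceD(1)[OF v] wiener_spaceD(1)[OF w] by (simp add: torus_periodic_def)
  show "(\<lambda>x. v x + w x) \<in> wiener_space r" "wiener_norm r (\<lambda>x. v x + w x) \<le> wiener_norm r v + wiener_norm r w"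
    by (rule wiener_norm_leI[OF le has_sum_add[OF has_sum_wiener_norm[OF v] has_sum_wiener_norm[OF w]] per];
        intro continuous_intros wiener_spaceD(2)[OF v] wiener_spaceD(2)[OF w])+
qed

lemma wiener_space_cmult:
  assumes v: "v \<in> wiener_space r"
  shows "(\<lambda>x. c * v x) \<in> wiener_space r" "wiener_norm r (\<lambda>x. c * v x) \<le> norm c * wiener_norm r v"
proof -
  have le: "freq_weight m ^ r * norm (fourier_coeff (\<lambda>x. c * v x) m)
      \<le> norm c * (freq_weight m ^ r * norm (fourier_coeff v m))" for m
    by (simp add: fourier_coeff_cmult norm_mult)
  have per: "torus_periodic (\<lambda>x. c * v x)"
    using wiener_spaceD(1)[OF v] by (simp add: torus_periodic_def)
  show "(\<lambda>x. c * v x) \<in> wiener_space r" "wiener_norm r (\<lambda>x. c * v x) \<le> norm c * wiener_norm r v"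
    by (rule wiener_norm_leI[OF le has_sum_cmult_right[OF has_sum_wiener_norm[OF v]] per];
        intro continuous_intros wiener_spaceD(2)[OF v])+
qed

lemma wiener_space_cnj:
  assumes v: "v \<in> wiener_space r"
  shows "(\<lambda>x. cnj (v x)) \<in> wiener_space r" "wiener_norm r (\<lambda>x. cnj (v x)) = wiener_norm r v"
proof -
  have bij: "bij_betw uminus (UNIV :: (int ^ 'd) set) UNIV"
    by (rule bij_betw_byWitness[of _ uminus]) auto
  have eq: "(\<lambda>m. freq_weight m ^ r * norm (fourier_coeff (\<lambda>x. cnj (v x)) m))
      = (\<lambda>m. (\<lambda>m. freq_weight m ^ r * norm (fourier_coeff v m)) (- m))"
    by (simp add: fourier_coeff_cnj)
  show "wiener_norm r (\<lambda>x. cnj (v x)) = wiener_norm r v"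
    unfolding wiener_norm_def eq by (rule infsum_reindex_bij_betw[OF bij])
  have "(\<lambda>m. freq_weight m ^ r * norm (fourier_coeff (\<lambda>x. cnj (v x)) m)) summable_on UNIV"
    unfolding eq
    using wiener_spaceD(3)[OF v] summable_on_reindex_bij_betw[OF bij, of "\<lambda>m. freq_weight m ^ r * norm (fourier_coeff v m)"]
    by blast
  thus "(\<lambda>x. cnj (v x)) \<in> wiener_space r"
    using wiener_spaceD(1,2)[OF v] by (auto simp: wiener_space_def torus_periodic_def intro!: continuous_intros)
qed

text \<open>
  The coefficients of a product are a convolution.  Submultiplicativity distributes the weight over
  the two frequencies, and the double series \<open>(m, n) \<mapsto> A\<^sub>n B\<^sub>m\<^sub>-\<^sub>n\<close> is a rearrangement of the product
  of the two series of norms.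
\<close>

lemma wiener_space_mult:
  fixes v w :: "real ^ 'd \<Rightarrow> complex"
  assumes v: "v \<in> wiener_space r" and w: "w \<in> wiener_space r"
  shows "(\<lambda>x. v x * w x) \<in> wiener_space r"
    "wiener_norm r (\<lambda>x. v x * w x) \<le> wiener_norm r v * wiener_norm r w"
proof -
  define A B where "A n = freq_weight n ^ r * norm (fourier_coeff v n)"
    and "B n = freq_weight n ^ r * norm (fourier_coeff w n)" for n
  have A: "(A has_sum wiener_norm r v) UNIV" and B: "(B has_sum wiener_norm r w) UNIV"
    unfolding A_def B_def by (intro has_sum_wiener_norm v w)+
  have nn: "A n \<ge> 0" "B n \<ge> 0" for n by (simp_all add: A_def B_def)
  have inner: "((\<lambda>l. A n * B l) has_sum A n * wiener_norm r w) UNIV" for n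
    by (rule has_sum_cmult_right[OF B])
  have outer: "((\<lambda>n. A n * wiener_norm r w) has_sum wiener_norm r v * wiener_norm r w) UNIV"
    by (rule has_sum_cmult_left[OF A])
  have "(\<lambda>(n, l). A n * B l) summable_on UNIV \<times> UNIV"
    by (rule summable_on_SigmaI[where g = "\<lambda>n. A n * wiener_norm r w"])
       (use inner has_sum_imp_summable[OF outer] nn in auto)
  hence AB: "((\<lambda>(n, l). A n * B l) has_sum wiener_norm r v * wiener_norm r w) (UNIV \<times> UNIV)"
    by (intro has_sum_SigmaI[OF _ outer]) (use inner in auto)
  have G: "((\<lambda>(m, n). A n * B (m - n)) has_sum wiener_norm r v * wiener_norm r w) (UNIV \<times> UNIV)"
    by (rule has_sum_reindex_bij_witness[THEN iffD1, OF _ _ _ _ _ _ AB,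
          where j1 = "\<lambda>(n, l). (n + l, n)" and i1 = "\<lambda>(m, n). (n, m - n)"]) auto
  have Gn: "(\<lambda>n. A n * B (m - n)) summable_on UNIV" for m
    using summable_on_SigmaD1[of "\<lambda>m n. A n * B (m - n)" UNIV "\<lambda>_. UNIV" m]
      has_sum_imp_summable[OF G] by simp
  have Gm: "((\<lambda>m. \<Sum>\<^sub>\<infinity>n. A n * B (m - n)) has_sum wiener_norm r v * wiener_norm r w) UNIV"
    by (rule has_sum_SigmaD[OF G]) (use Gn in auto)
  have le: "freq_weight m ^ r * norm (fourier_coeff (\<lambda>x. v x * w x) m) \<le> (\<Sum>\<^sub>\<infinity>n. A n * B (m - n))" for m
  proof -
    have "((\<lambda>n. fourier_coeff v n * fourier_coeff w (m - n)) has_sum fourier_coeff (\<lambda>x. v x * w x) m) UNIV"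
      using fourier_coeff_fourier_series_mult[OF wiener_space_summable[OF v] wiener_spaceD(1,2)[OF w], of m]
        wiener_space_inversion[OF v] by metis
    hence "((\<lambda>n. of_real (freq_weight m ^ r) * (fourier_coeff v n * fourier_coeff w (m - n)))
        has_sum of_real (freq_weight m ^ r) * fourier_coeff (\<lambda>x. v x * w x) m) UNIV"
      by (rule has_sum_cmult_right)
    moreover have "((\<lambda>n. A n * B (m - n)) has_sum (\<Sum>\<^sub>\<infinity>n. A n * B (m - n))) UNIV"
      using Gn by simp
    ultimately have "norm (of_real (freq_weight m ^ r) * fourier_coeff (\<lambda>x. v x * w x) m) \<le> (\<Sum>\<^sub>\<infinity>n. A n * B (m - n))"
    proof (rule norm_infsum_le)
      fix n
      have "freq_weight m ^ r \<le> (freq_weight n * freq_weight (m - n)) ^ r"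
        using freq_weight_add_le[of n "m - n"] by (intro power_mono) auto
      hence "freq_weight m ^ r * (norm (fourier_coeff v n) * norm (fourier_coeff w (m - n)))
          \<le> (freq_weight n * freq_weight (m - n)) ^ r * (norm (fourier_coeff v n) * norm (fourier_coeff w (m - n)))"
        by (rule mult_right_mono) simp
      thus "norm (of_real (freq_weight m ^ r) * (fourier_coeff v n * fourier_coeff w (m - n))) \<le> A n * B (m - n)"
        by (simp add: A_def B_def norm_mult norm_power power_mult_distrib mult_ac)
    qed
    thus ?thesis by (simp add: norm_mult norm_power)
  qed
  have per: "torus_periodic (\<lambda>x. v x * w x)"
    using wiener_spaceD(1)[OF v] wiener_spaceD(1)[OF w] by (simp add: torus_periodic_def)
  show "(\<lambda>x. v x * w x) \<in> wiener_space r" "wiener_norm r (\<lambda>x. v x * w x) \<le> wiener_norm r v * wiener_norm r w"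
    by (rule wiener_norm_leI[OF le Gm per]; intro continuous_intros wiener_spaceD(2)[OF v] wiener_spaceD(2)[OF w])+
qed

section \<open>Derivatives of Fourier series\<close>

lemma has_sum_diff:
  fixes f g :: "'a \<Rightarrow> 'b::real_normed_vector"
  assumes "(f has_sum a) A" "(g has_sum b) A"
  shows "((\<lambda>x. f x - g x) has_sum (a - b)) A"
  using has_sum_add[OF assms(1), of "\<lambda>x. - g x" "- b"] assms(2) by (simp add: has_sum_uminus)

lemma norm_cis_taylor: "norm (cis t - 1 - \<i> * of_real t) \<le> t\<^sup>2"
  using Taylor_exp[of "\<i> * of_real t" 1]
  by (simp add: cis_conv_exp norm_mult power2_eq_square algebra_simps)

text \<open>
  The increment of the character of frequency \<open>m\<close> along the \<open>i\<close>-th axis differs from its linear part by at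
  most \<open>m\<^sub>i\<^sup>2 \<tau>\<^sup>2\<close>.  As the weight dominates \<open>m\<^sub>i\<^sup>2\<close>, these errors sum up to \<open>O(\<tau>\<^sup>2)\<close>.
\<close>

lemma fourier_series_has_partial_derivative:
  fixes a :: "int ^ 'd \<Rightarrow> complex"
  assumes a: "(\<lambda>m. freq_weight m * norm (a m)) summable_on UNIV"
  shows "((\<lambda>\<tau>. fourier_series a (x + \<tau> *\<^sub>R axis i 1)) has_vector_derivative
           fourier_series (\<lambda>m. \<i> * of_int (m $ i) * a m) x) (at 0)"
proof -
  define K where "K = (\<Sum>\<^sub>\<infinity>m. freq_weight m * norm (a m))"
  have a0: "(\<lambda>m. norm (a m)) summable_on UNIV"
    by (rule summable_on_comparison_test[OF a])
       (use mult_right_mono[OF freq_weight_ge_1, of "norm (a m)" m for m] in auto)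
  have a1: "(\<lambda>m. norm (\<i> * of_int (m $ i) * a m)) summable_on UNIV"
    by (rule summable_on_comparison_test[OF a])
       (auto simp: norm_mult intro!: mult_right_mono abs_freq_le_weight)
  have bound: "norm (fourier_series a (x + \<tau> *\<^sub>R axis i 1) - fourier_series a x
      - \<tau> *\<^sub>R fourier_series (\<lambda>m. \<i> * of_int (m $ i) * a m) x) \<le> K * \<tau>\<^sup>2" for \<tau>
  proof (rule norm_infsum_le)
    show "((\<lambda>m. a m * character m (x + \<tau> *\<^sub>R axis i 1) - a m * character m x
        - \<tau> *\<^sub>R (\<i> * of_int (m $ i) * a m * character m x)) has_sum
        (fourier_series a (x + \<tau> *\<^sub>R axis i 1) - fourier_series a x
      - \<tau> *\<^sub>R fourier_series (\<lambda>m. \<i> * of_int (m $ i) * a m) x)) UNIV"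
      unfolding fourier_series_def
      by (intro has_sum_diff has_sum_scaleR has_sum_infsum summable_fourier_series a0 a1)
    show "((\<lambda>m. freq_weight m * norm (a m) * \<tau>\<^sup>2) has_sum (K * \<tau>\<^sup>2)) UNIV"
      unfolding K_def by (intro has_sum_cmult_left has_sum_infsum a)
    fix m
    have "a m * character m (x + \<tau> *\<^sub>R axis i 1) - a m * character m x
        - \<tau> *\<^sub>R (\<i> * of_int (m $ i) * a m * character m x)
        = a m * character m x * (cis (of_int (m $ i) * \<tau>) - 1 - \<i> * of_real (of_int (m $ i) * \<tau>))"
      unfolding character_translate by (simp add: scaleR_conv_of_real algebra_simps)
    hence "norm (a m * character m (x + \<tau> *\<^sub>R axis i 1) - a m * character m x
        - \<tau> *\<^sub>R (\<i> * of_int (m $ i) * a m * character m x))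
        = norm (a m) * norm (cis (of_int (m $ i) * \<tau>) - 1 - \<i> * of_real (of_int (m $ i) * \<tau>))"
      by (simp add: norm_mult)
    also have "\<dots> \<le> norm (a m) * (of_int (m $ i) * \<tau>)\<^sup>2"
      by (intro mult_left_mono norm_cis_taylor) simp
    also have "\<dots> \<le> norm (a m) * (freq_weight m * \<tau>\<^sup>2)"
      unfolding power_mult_distrib by (intro mult_left_mono mult_right_mono square_freq_le_weight) auto
    finally show "norm (a m * character m (x + \<tau> *\<^sub>R axis i 1) - a m * character m x
        - \<tau> *\<^sub>R (\<i> * of_int (m $ i) * a m * character m x)) \<le> freq_weight m * norm (a m) * \<tau>\<^sup>2"
      by (simp add: mult_ac)
  qed
  show ?thesis
    unfolding has_vector_derivative_def
  proof (rule has_derivativeI_sandwich[of 1])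
    show "norm (fourier_series a (x + \<tau> *\<^sub>R axis i 1) - fourier_series a (x + 0 *\<^sub>R axis i 1)
      - (\<tau> - 0) *\<^sub>R fourier_series (\<lambda>m. \<i> * of_int (m $ i) * a m) x) / norm (\<tau> - 0) \<le> K * \<bar>\<tau>\<bar>"
      if "\<tau> \<noteq> 0" for \<tau>
    proof -
      have "norm (fourier_series a (x + \<tau> *\<^sub>R axis i 1) - fourier_series a x
          - \<tau> *\<^sub>R fourier_series (\<lambda>m. \<i> * of_int (m $ i) * a m) x) / \<bar>\<tau>\<bar> \<le> K * \<tau>\<^sup>2 / \<bar>\<tau>\<bar>"
        by (intro divide_right_mono bound) simp
      also have "\<tau>\<^sup>2 = \<bar>\<tau>\<bar> * \<bar>\<tau>\<bar>" by (simp add: power2_eq_square)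
      also have "K * (\<bar>\<tau>\<bar> * \<bar>\<tau>\<bar>) / \<bar>\<tau>\<bar> = K * \<bar>\<tau>\<bar>"
        using that by (metis abs_eq_0 mult.assoc nonzero_mult_div_cancel_right)
      finally show ?thesis by simp
    qed
    show "((\<lambda>\<tau>. K * \<bar>\<tau>\<bar>) \<longlongrightarrow> 0) (at 0)"
      by (auto intro!: tendsto_eq_intros)
  qed (auto intro!: bounded_linear_intros)
qed

lemma partial_deriv_fourier_series:
  fixes v :: "real ^ 'd \<Rightarrow> complex"
  assumes v: "v \<in> wiener_space (Suc r)"
  shows "partial_deriv i v = fourier_series (\<lambda>m. \<i> * of_int (m $ i) * fourier_coeff v m)"
proof
  fix x
  have "(\<lambda>m. freq_weight m * norm (fourier_coeff v m)) summable_on UNIV"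
    using wiener_spaceD(3)[OF wiener_space_mono(1)[OF v, of 1]] by simp
  from fourier_series_has_partial_derivative[OF this]
  show "partial_deriv i v x = fourier_series (\<lambda>m. \<i> * of_int (m $ i) * fourier_coeff v m) x"
    unfolding partial_deriv_def wiener_space_inversion[OF v, symmetric] by (rule vector_derivative_at)
qed

text \<open>
  A first derivative costs at most one factor of the weight, because \<open>|m\<^sub>i| \<le> \<omega>(m)\<close>.
\<close>

lemma partial_deriv_wiener_space:
  fixes v :: "real ^ 'd \<Rightarrow> complex"
  assumes v: "v \<in> wiener_space (Suc r)"
  shows "fourier_coeff (partial_deriv i v) m = \<i> * of_int (m $ i) * fourier_coeff v m"
    and "partial_deriv i v \<in> wiener_space r"
    and "wiener_norm r (partial_deriv i v) \<le> wiener_norm (Suc r) v"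
proof -
  have le: "freq_weight m ^ r * norm (\<i> * of_int (m $ i) * fourier_coeff v m)
      \<le> freq_weight m ^ Suc r * norm (fourier_coeff v m)" for m
  proof -
    have "(freq_weight m ^ r * norm (fourier_coeff v m)) * \<bar>of_int (m $ i)\<bar>
        \<le> (freq_weight m ^ r * norm (fourier_coeff v m)) * freq_weight m"
      by (intro mult_left_mono abs_freq_le_weight) simp
    thus ?thesis by (simp add: norm_mult mult_ac)
  qed
  have le0: "norm (\<i> * of_int (m $ i) * fourier_coeff v m) \<le> freq_weight m ^ Suc r * norm (fourier_coeff v m)" for m
  proof -
    have "1 * norm (\<i> * of_int (m $ i) * fourier_coeff v m) \<le> freq_weight m ^ r * norm (\<i> * of_int (m $ i) * fourier_coeff v m)"
      by (intro mult_right_mono one_le_power freq_weight_ge_1) simp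
    thus ?thesis using le[of m] by simp
  qed
  have s: "(\<lambda>m. norm (\<i> * of_int (m $ i) * fourier_coeff v m)) summable_on UNIV"
    by (rule summable_on_comparison_test[OF wiener_spaceD(3)[OF v]]) (rule le0, simp)
  have fc: "fourier_coeff (partial_deriv i v) m = \<i> * of_int (m $ i) * fourier_coeff v m" for m
    unfolding partial_deriv_fourier_series[OF v] by (rule fourier_coeff_fourier_series[OF s])
  show "fourier_coeff (partial_deriv i v) m = \<i> * of_int (m $ i) * fourier_coeff v m" by (rule fc)
  have per: "torus_periodic (partial_deriv i v)" and c: "continuous_on UNIV (partial_deriv i v)"
    unfolding partial_deriv_fourier_series[OF v]
    by (rule torus_periodic_fourier_series, rule continuous_fourier_series[OF s])
  show "partial_deriv i v \<in> wiener_space r" "wiener_norm r (partial_deriv i v) \<le> wiener_norm (Suc r) v"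
    by (rule wiener_norm_leI[OF _ has_sum_wiener_norm[OF v] per c]; simp only: fc le)+
qed

text \<open>
  Two nested derivatives require two factors of the weight for termwise differentiation, but the size of
  the result is governed by \<open>|m|\<^sup>2\<close>, that is, by a single factor.
\<close>

lemma laplacian_wiener_space:
  fixes v :: "real ^ 'd \<Rightarrow> complex"
  assumes v: "v \<in> wiener_space (Suc (Suc r))"
  shows "fourier_coeff (laplacian v) m = - of_real (freq_sq m) * fourier_coeff v m"
    and "laplacian v \<in> wiener_space r"
    and "wiener_norm r (laplacian v) \<le> wiener_norm (Suc r) v"
proof -
  note 1 = partial_deriv_wiener_space(2)[OF v]
  note 2 = partial_deriv_wiener_space(2)[OF 1]
  have cont: "continuous_on UNIV (partial_deriv i (partial_deriv i v))" for i
    by (rule wiener_spaceD(2)[OF 2])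
  have fc: "fourier_coeff (laplacian v) m = - of_real (freq_sq m) * fourier_coeff v m" for m
  proof -
    have "fourier_coeff (\<lambda>x. \<Sum>i\<in>A. partial_deriv i (partial_deriv i v) x) m
        = (\<Sum>i\<in>A. fourier_coeff (partial_deriv i (partial_deriv i v)) m)" if "finite A" for A
      using that
    proof (induction A rule: finite_induct)
      case (insert i A)
      thus ?case by (simp add: fourier_coeff_add continuous_on_sum cont)
    qed (simp add: fourier_coeff_def torus_mean_def)
    hence "fourier_coeff (laplacian v) m = (\<Sum>i\<in>UNIV. fourier_coeff (partial_deriv i (partial_deriv i v)) m)"
      by (simp add: laplacian_def[abs_def])
    also have "\<dots> = (\<Sum>i\<in>UNIV. - (of_int (m $ i))\<^sup>2 * fourier_coeff v m)"
      by (intro sum.cong refl)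
         (simp add: partial_deriv_wiener_space(1)[OF 1] partial_deriv_wiener_space(1)[OF v] power2_eq_square algebra_simps)
    also have "\<dots> = - of_real (freq_sq m) * fourier_coeff v m"
      by (simp add: freq_sq_def sum_distrib_right[symmetric] sum_negf)
    finally show ?thesis .
  qed
  show "fourier_coeff (laplacian v) m = - of_real (freq_sq m) * fourier_coeff v m" by (rule fc)
  have le: "freq_weight m ^ r * norm (fourier_coeff (laplacian v) m) \<le> freq_weight m ^ Suc r * norm (fourier_coeff v m)" for m
  proof -
    have "(freq_weight m ^ r * norm (fourier_coeff v m)) * freq_sq m
        \<le> (freq_weight m ^ r * norm (fourier_coeff v m)) * freq_weight m"
      by (intro mult_left_mono freq_sq_le_weight) simp
    thus ?thesis unfolding fc using freq_sq_nonneg[of m] by (simp add: norm_mult mult_ac)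
  qed
  have per: "torus_periodic (laplacian v)"
    using wiener_spaceD(1)[OF 2] by (simp add: torus_periodic_def laplacian_def)
  have c: "continuous_on UNIV (laplacian v)"
    unfolding laplacian_def[abs_def] by (intro continuous_on_sum cont)
  show "laplacian v \<in> wiener_space r" "wiener_norm r (laplacian v) \<le> wiener_norm (Suc r) v"
    by (rule wiener_norm_leI[OF le has_sum_wiener_norm[OF wiener_space_mono(1)[OF v]] per c]; simp)+
qed

lemma partial_deriv_diff:
  assumes v: "v \<in> wiener_space (Suc r)" and w: "w \<in> wiener_space (Suc r)"
  shows "partial_deriv i (\<lambda>x. v x - w x) x = partial_deriv i v x - partial_deriv i w x"
proof -
  note d = wiener_space_diff(1)[OF v w]
  have "partial_deriv i (\<lambda>x. v x - w x) = (\<lambda>x. partial_deriv i v x - partial_deriv i w x)"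
    by (rule wiener_space_eqI[OF partial_deriv_wiener_space(2)[OF d]
          wiener_space_diff(1)[OF partial_deriv_wiener_space(2)[OF v] partial_deriv_wiener_space(2)[OF w]]])
       (simp add: partial_deriv_wiener_space(1)[OF d] partial_deriv_wiener_space(1)[OF v]
          partial_deriv_wiener_space(1)[OF w] fourier_coeff_diff wiener_spaceD(2)[OF v] wiener_spaceD(2)[OF w]
          wiener_spaceD(2)[OF partial_deriv_wiener_space(2)[OF v]]
          wiener_spaceD(2)[OF partial_deriv_wiener_space(2)[OF w]] algebra_simps)
  thus ?thesis by metis
qed

lemma laplacian_diff:
  assumes v: "v \<in> wiener_space (Suc (Suc r))" and w: "w \<in> wiener_space (Suc (Suc r))"
  shows "laplacian (\<lambda>x. v x - w x) x = laplacian v x - laplacian w x"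
proof -
  note d = wiener_space_diff(1)[OF v w]
  have "partial_deriv i (\<lambda>x. v x - w x) = (\<lambda>x. partial_deriv i v x - partial_deriv i w x)" for i
    using partial_deriv_diff[OF v w] by (intro ext)
  thus ?thesis
    by (simp add: laplacian_def partial_deriv_diff[OF partial_deriv_wiener_space(2)[OF v]
          partial_deriv_wiener_space(2)[OF w]] sum_subtractf)
qed

section \<open>Embedding of Sobolev spaces\<close>

lemma summable_on_inverse_square_int: "(\<lambda>k::int. 1 / (1 + (real_of_int k)\<^sup>2)) summable_on UNIV"
proof -
  define g where "g k = 1 / (1 + (real_of_int k)\<^sup>2)" for k :: int
  have "summable (\<lambda>n. 1 / (1 + (real n)\<^sup>2))"
  proof (rule summable_comparison_test)
    show "summable (\<lambda>n. inverse ((real n)\<^sup>2))" by (rule inverse_power_summable) simp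
    show "\<exists>N. \<forall>n\<ge>N. norm (1 / (1 + (real n)\<^sup>2)) \<le> inverse ((real n)\<^sup>2)"
      by (rule exI[of _ 1]) (auto simp: field_simps add_pos_nonneg)
  qed
  hence nat: "(\<lambda>n. 1 / (1 + (real n)\<^sup>2)) summable_on UNIV"
    by (subst summable_on_UNIV_nonneg_real_iff) auto
  have "g summable_on range int"
    using nat by (subst summable_on_reindex) (auto simp: o_def g_def)
  moreover have "g summable_on range (\<lambda>n. - int n)"
    using nat by (subst summable_on_reindex) (auto simp: o_def g_def inj_def)
  ultimately have "g summable_on range int \<union> range (\<lambda>n. - int n)"
    by (rule summable_on_union)
  moreover have "range int \<union> range (\<lambda>n. - int n) = UNIV"
  proof (intro equalityI subsetI)
    fix k :: int
    show "k \<in> range int \<union> range (\<lambda>n. - int n)" by (cases k rule: int_cases2) auto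
  qed auto
  ultimately show ?thesis by (simp add: g_def[abs_def])
qed

text \<open>
  By \<open>(1 + |m|\<^sup>2)\<^sup>d \<ge> (1 + m\<^sub>1\<^sup>2) \<dots> (1 + m\<^sub>d\<^sup>2)\<close> the lattice sum is dominated by the \<open>d\<close>-th power of a
  one-dimensional sum.
\<close>

lemma summable_on_lattice:
  "(\<lambda>m :: int ^ 'd. 1 / (1 + freq_sq m) ^ CARD('d)) summable_on UNIV"
proof (rule nonneg_bdd_above_summable_on)
  define g where "g k = 1 / (1 + (real_of_int k)\<^sup>2)" for k :: int
  show "0 \<le> 1 / (1 + freq_sq m) ^ CARD('d)" for m :: "int ^ 'd"
    using freq_sq_nonneg[of m] by simp
  have le: "1 / (1 + freq_sq m) ^ CARD('d) \<le> (\<Prod>i\<in>UNIV. g (m $ i))" for m :: "int ^ 'd"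
  proof -
    have "(\<Prod>i\<in>UNIV. 1 + (real_of_int (m $ i))\<^sup>2) \<le> (\<Prod>i\<in>(UNIV :: 'd set). 1 + freq_sq m)"
    proof (rule prod_mono)
      fix i :: 'd
      have "(real_of_int (m $ i))\<^sup>2 \<le> freq_sq m"
        unfolding freq_sq_def by (rule member_le_sum) auto
      thus "0 \<le> 1 + (real_of_int (m $ i))\<^sup>2 \<and> 1 + (real_of_int (m $ i))\<^sup>2 \<le> 1 + freq_sq m" by simp
    qed
    moreover have "(\<Prod>i\<in>UNIV. 1 + (real_of_int (m $ i))\<^sup>2) > 0"
      by (rule prod_pos) (simp add: add_pos_nonneg)
    ultimately show ?thesis
      by (simp add: g_def prod_dividef frac_le)
  qed
  show "bdd_above (sum (\<lambda>m :: int ^ 'd. 1 / (1 + freq_sq m) ^ CARD('d)) ` {F. F \<subseteq> UNIV \<and> finite F})"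
  proof (rule bdd_aboveI2)
    fix F :: "(int ^ 'd) set" assume "F \<in> {F. F \<subseteq> UNIV \<and> finite F}"
    hence F: "finite F" by simp
    \<comment> \<open>\<open>F\<close> is contained in the product of \<open>d\<close> copies of a finite set of integers\<close>
    define B where "B = (\<Union>m\<in>F. range (($) m))"
    have B: "finite B" using F by (simp add: B_def)
    have "(\<Sum>m\<in>F. 1 / (1 + freq_sq m) ^ CARD('d)) \<le> (\<Sum>m\<in>F. \<Prod>i\<in>UNIV. g (m $ i))"
      by (rule sum_mono) (rule le)
    also have "\<dots> = (\<Sum>f\<in>($) ` F. \<Prod>i\<in>UNIV. g (f i))"
      by (subst sum.reindex) (auto simp: inj_on_def vec_nth_inject)
    also have "\<dots> \<le> (\<Sum>f\<in>PiE (UNIV :: 'd set) (\<lambda>_. B). \<Prod>i\<in>UNIV. g (f i))"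
    proof (rule sum_mono2)
      show "finite (PiE (UNIV :: 'd set) (\<lambda>_. B))" using B by (intro finite_PiE) auto
    qed (auto simp: B_def g_def intro!: prod_nonneg)
    also have "\<dots> = (\<Prod>i\<in>(UNIV :: 'd set). \<Sum>k\<in>B. g k)"
      using B by (subst prod_sum_PiE) auto
    also have "\<dots> \<le> (\<Prod>i\<in>(UNIV :: 'd set). \<Sum>\<^sub>\<infinity>k. g k)"
    proof (intro prod_mono conjI)
      show "(\<Sum>k\<in>B. g k) \<le> (\<Sum>\<^sub>\<infinity>k. g k)"
        using B summable_on_inverse_square_int
        by (intro finite_sum_le_infsum) (auto simp: g_def[abs_def])
    qed (auto simp: g_def intro!: sum_nonneg)
    finally show "(\<Sum>m\<in>F. 1 / (1 + freq_sq m) ^ CARD('d)) \<le> (\<Prod>i\<in>(UNIV :: 'd set). \<Sum>\<^sub>\<infinity>k. g k)" .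
  qed
qed

definition embedding_const :: "'d::finite itself \<Rightarrow> real" where
  "embedding_const _ = 4 * sqrt (\<Sum>\<^sub>\<infinity>m :: int ^ 'd. 1 / (1 + freq_sq m) ^ CARD('d))"

text \<open>
  Cauchy-Schwarz after splitting \<open>\<omega>\<^sup>2 |c|\<close>, where \<open>c\<close> is the coefficient of frequency \<open>m\<close>, into
  \<open>\<omega>\<^sup>2 (1 + |m|\<^sup>2)\<^sup>-\<^sup>s\<^sup>/\<^sup>2\<close> and \<open>(1 + |m|\<^sup>2)\<^sup>s\<^sup>/\<^sup>2 |c|\<close>.
  The square of the first factor is \<open>16 (1 + |m|\<^sup>2)\<^sup>4\<^sup>-\<^sup>s\<close>, which is summable over the lattice
  since \<open>s - 4 \<ge> d\<close>.
\<close>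

lemma wiener_norm_le_sobolev_norm:
  fixes v :: "real ^ 'd \<Rightarrow> complex"
  assumes s: "s \<ge> real CARD('d) + 4" and v: "torus_periodic v" "continuous_on UNIV v"
    and sum: "(\<lambda>m. sobolev_weight s m * (cmod (fourier_coeff v m))\<^sup>2) summable_on UNIV"
  shows "v \<in> wiener_space 2" "wiener_norm 2 v \<le> embedding_const TYPE('d) * sobolev_norm s v"
proof -
  let ?L = "\<Sum>\<^sub>\<infinity>m :: int ^ 'd. 1 / (1 + freq_sq m) ^ CARD('d)"
  let ?c = "\<lambda>m. freq_weight m ^ 2 * cmod (fourier_coeff v m)"
  have fin: "sum ?c F \<le> embedding_const TYPE('d) * sobolev_norm s v" if F: "finite F" for F
  proof -
    define X where "X m = freq_weight m ^ 2 * (1 + freq_sq m) powr (- s / 2)" for m :: "int ^ 'd"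
    define Y where "Y m = (1 + freq_sq m) powr (s / 2) * cmod (fourier_coeff v m)" for m
    have pos: "1 + freq_sq m > 0" for m :: "int ^ 'd" using freq_sq_nonneg[of m] by linarith
    have XY: "?c m = X m * Y m" for m
      using pos[of m] by (simp add: X_def Y_def powr_minus field_simps)
    have X2: "(X m)\<^sup>2 \<le> 16 * (1 / (1 + freq_sq m) ^ CARD('d))" for m
    proof -
      have "(X m)\<^sup>2 = 16 * ((1 + freq_sq m) powr 4 * (1 + freq_sq m) powr (- s))"
        using pos[of m] by (simp add: X_def freq_weight_def power_mult_distrib powr_power powr_numeral del: distrib_left_numeral)
      also have "\<dots> = 16 * (1 + freq_sq m) powr (4 - s)"
        by (simp add: powr_add[symmetric])
      also have "\<dots> \<le> 16 * (1 + freq_sq m) powr (- real CARD('d))"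
        using s freq_sq_nonneg[of m] by (intro mult_left_mono powr_mono) auto
      also have "(1 + freq_sq m) powr (- real CARD('d)) = 1 / (1 + freq_sq m) ^ CARD('d)"
        using pos[of m] by (simp add: powr_minus powr_realpow field_simps)
      finally show ?thesis .
    qed
    have Y2: "(Y m)\<^sup>2 = sobolev_weight s m * (cmod (fourier_coeff v m))\<^sup>2" for m
      using pos[of m] by (simp add: Y_def power_mult_distrib powr_power sobolev_weight_def freq_sq_def)
    have "(sum ?c F)\<^sup>2 \<le> (\<Sum>m\<in>F. (X m)\<^sup>2) * (\<Sum>m\<in>F. (Y m)\<^sup>2)"
      unfolding XY by (rule Cauchy_Schwarz_ineq_sum)
    also have "\<dots> \<le> (16 * ?L) * (sobolev_norm s v)\<^sup>2"
    proof (rule mult_mono)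
      have "(\<Sum>m\<in>F. (X m)\<^sup>2) \<le> (\<Sum>m\<in>F. 16 * (1 / (1 + freq_sq m) ^ CARD('d)))"
        by (rule sum_mono) (rule X2)
      also have "\<dots> = 16 * (\<Sum>m\<in>F. 1 / (1 + freq_sq m) ^ CARD('d))"
        by (simp only: sum_distrib_left)
      also have "\<dots> \<le> 16 * ?L"
        using F by (intro mult_left_mono finite_sum_le_infsum summable_on_lattice) (auto simp: freq_sq_nonneg)
      finally show "(\<Sum>m\<in>F. (X m)\<^sup>2) \<le> 16 * ?L" .
      have "(\<Sum>m\<in>F. (Y m)\<^sup>2) \<le> (\<Sum>\<^sub>\<infinity>m. sobolev_weight s m * (cmod (fourier_coeff v m))\<^sup>2)"
        unfolding Y2 using F sum by (intro finite_sum_le_infsum) (auto simp: sobolev_weight_def)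
      also have "\<dots> = (sobolev_norm s v)\<^sup>2"
        unfolding sobolev_norm_def by (simp add: infsum_nonneg sobolev_weight_def)
      finally show "(\<Sum>m\<in>F. (Y m)\<^sup>2) \<le> (sobolev_norm s v)\<^sup>2" .
      show "0 \<le> 16 * ?L" by (simp add: infsum_nonneg freq_sq_nonneg)
    qed (simp add: sum_nonneg)
    also have "\<dots> = (embedding_const TYPE('d) * sobolev_norm s v)\<^sup>2"
      by (simp add: embedding_const_def power_mult_distrib infsum_nonneg freq_sq_nonneg)
    finally show ?thesis
      by (rule power2_le_imp_le)
         (simp add: embedding_const_def sobolev_norm_def infsum_nonneg freq_sq_nonneg sobolev_weight_def)
  qed
  have s: "?c summable_on UNIV"
    by (rule nonneg_bdd_above_summable_on) (use fin in \<open>auto intro!: bdd_aboveI2\<close>)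
  show "v \<in> wiener_space 2" using v s by (simp add: wiener_space_def)
  show "wiener_norm 2 v \<le> embedding_const TYPE('d) * sobolev_norm s v"
    unfolding wiener_norm_def by (rule infsum_le_finite_sums[OF s]) (rule fin)
qed

section \<open>Continuous paths in the Wiener algebra\<close>

text \<open>
  Continuity into the Wiener algebra with \<open>r = 2\<close>, the order in which the right-hand side of the Schroedinger
  equation is a continuous function of time and space.
\<close>

definition wiener_path :: "real set \<Rightarrow> (real \<Rightarrow> real ^ 'd \<Rightarrow> complex) \<Rightarrow> bool" where
  "wiener_path I w \<longleftrightarrow> (\<forall>t\<in>I. w t \<in> wiener_space 2
     \<and> ((\<lambda>\<tau>. wiener_norm 2 (\<lambda>x. w \<tau> x - w t x)) \<longlongrightarrow> 0) (at t within I))"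

lemma eventually_at_within_mem: "\<forall>\<^sub>F \<tau> in at t within I. \<tau> \<in> I"
  by (simp add: eventually_at_filter)

lemma wiener_path_of_sobolev:
  fixes w :: "real \<Rightarrow> real ^ 'd \<Rightarrow> complex"
  assumes s: "s \<ge> real CARD('d) + 4" and w: "continuous_into_sobolev s I w"
    and cont: "\<And>t. t \<in> I \<Longrightarrow> continuous_on UNIV (w t)"
  shows "wiener_path I w"
  unfolding wiener_path_def
proof (intro ballI conjI)
  have mem: "torus_periodic (w t)" "(\<lambda>m. sobolev_weight s m * (cmod (fourier_coeff (w t) m))\<^sup>2) summable_on UNIV"
    if "t \<in> I" for t
    using w that by (auto simp: continuous_into_sobolev_def sobolev_space_def)
  fix t assume t: "t \<in> I"
  show "w t \<in> wiener_space 2"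
    by (rule wiener_norm_le_sobolev_norm(1)[OF s mem(1)[OF t] cont[OF t] mem(2)[OF t]])
  have le: "wiener_norm 2 (\<lambda>x. w \<tau> x - w t x) \<le> embedding_const TYPE('d) * sobolev_norm s (\<lambda>x. w \<tau> x - w t x)"
    if \<tau>: "\<tau> \<in> I" for \<tau>
  proof (rule wiener_norm_le_sobolev_norm(2)[OF s])
    show "torus_periodic (\<lambda>x. w \<tau> x - w t x)"
      using mem(1)[OF t] mem(1)[OF \<tau>] by (simp add: torus_periodic_def)
    show "continuous_on UNIV (\<lambda>x. w \<tau> x - w t x)"
      by (intro continuous_intros cont t \<tau>)
    have "(\<lambda>m. 2 * (sobolev_weight s m * (cmod (fourier_coeff (w \<tau>) m))\<^sup>2)
             + 2 * (sobolev_weight s m * (cmod (fourier_coeff (w t) m))\<^sup>2)) summable_on UNIV"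
      by (intro summable_on_add summable_on_cmult_right mem t \<tau>)
    thus "(\<lambda>m. sobolev_weight s m * (cmod (fourier_coeff (\<lambda>x. w \<tau> x - w t x) m))\<^sup>2) summable_on UNIV"
    proof (rule summable_on_comparison_test)
      fix m
      let ?a = "fourier_coeff (w \<tau>) m" and ?b = "fourier_coeff (w t) m"
      have "(cmod (?a - ?b))\<^sup>2 \<le> (cmod ?a + cmod ?b)\<^sup>2"
        by (intro power_mono norm_triangle_ineq4) simp
      also have "\<dots> \<le> 2 * (cmod ?a)\<^sup>2 + 2 * (cmod ?b)\<^sup>2"
        using zero_le_power2[of "cmod ?a - cmod ?b"] by (simp add: power2_eq_square algebra_simps)
      finally have "sobolev_weight s m * (cmod (?a - ?b))\<^sup>2 \<le> sobolev_weight s m * (2 * (cmod ?a)\<^sup>2 + 2 * (cmod ?b)\<^sup>2)"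
        by (intro mult_left_mono) (simp_all add: sobolev_weight_def)
      thus "sobolev_weight s m * (cmod (fourier_coeff (\<lambda>x. w \<tau> x - w t x) m))\<^sup>2
         \<le> 2 * (sobolev_weight s m * (cmod ?a)\<^sup>2) + 2 * (sobolev_weight s m * (cmod ?b)\<^sup>2)"
        by (simp add: fourier_coeff_diff cont t \<tau> algebra_simps)
    qed (simp add: sobolev_weight_def)
  qed
  show "((\<lambda>\<tau>. wiener_norm 2 (\<lambda>x. w \<tau> x - w t x)) \<longlongrightarrow> 0) (at t within I)"
  proof (rule tendsto_sandwich[OF _ _ tendsto_const])
    show "((\<lambda>\<tau>. embedding_const TYPE('d) * sobolev_norm s (\<lambda>x. w \<tau> x - w t x)) \<longlongrightarrow> 0) (at t within I)"
      using w t by (intro tendsto_mult_right_zero) (auto simp: continuous_into_sobolev_def)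
  qed (use eventually_at_within_mem[of I t] in \<open>auto elim!: eventually_mono simp: le wiener_norm_nonneg\<close>)
qed

lemma wiener_pathD: "wiener_path I w \<Longrightarrow> t \<in> I \<Longrightarrow> w t \<in> wiener_space 2"
  by (simp add: wiener_path_def)

lemma wiener_path_const:
  assumes v: "v \<in> wiener_space 2" and w: "\<And>t. t \<in> I \<Longrightarrow> w t = v"
  shows "wiener_path I w"
  unfolding wiener_path_def
proof (intro ballI conjI)
  fix t assume t: "t \<in> I"
  show "w t \<in> wiener_space 2" using v w t by simp
  have "wiener_norm 2 (\<lambda>x. w \<tau> x - w t x) = 0" if "\<tau> \<in> I" for \<tau>
    using w[OF t] w[OF that] by (simp add: wiener_norm_def fourier_coeff_def torus_mean_def)
  hence "\<forall>\<^sub>F \<tau> in at t within I. wiener_norm 2 (\<lambda>x. w \<tau> x - w t x) = 0"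
    using eventually_at_within_mem[of I t] by (auto elim!: eventually_mono)
  thus "((\<lambda>\<tau>. wiener_norm 2 (\<lambda>x. w \<tau> x - w t x)) \<longlongrightarrow> 0) (at t within I)"
    by (rule tendsto_eventually)
qed

lemma wiener_path_diff:
  assumes v: "wiener_path I v" and w: "wiener_path I w"
  shows "wiener_path I (\<lambda>t x. v t x - w t x)"
  unfolding wiener_path_def
proof (intro ballI conjI)
  fix t assume t: "t \<in> I"
  show "(\<lambda>x. v t x - w t x) \<in> wiener_space 2"
    by (rule wiener_space_diff(1)[OF wiener_pathD[OF v t] wiener_pathD[OF w t]])
  let ?dv = "\<lambda>\<tau> x. v \<tau> x - v t x" and ?dw = "\<lambda>\<tau> x. w \<tau> x - w t x"
  have le: "wiener_norm 2 (\<lambda>x. (v \<tau> x - w \<tau> x) - (v t x - w t x)) \<le> wiener_norm 2 (?dv \<tau>) + wiener_norm 2 (?dw \<tau>)"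
    if \<tau>: "\<tau> \<in> I" for \<tau>
    using wiener_space_diff(2)[OF wiener_space_diff(1)[OF wiener_pathD[OF v \<tau>] wiener_pathD[OF v t]]
        wiener_space_diff(1)[OF wiener_pathD[OF w \<tau>] wiener_pathD[OF w t]]]
    by (simp add: algebra_simps)
  show "((\<lambda>\<tau>. wiener_norm 2 (\<lambda>x. (v \<tau> x - w \<tau> x) - (v t x - w t x))) \<longlongrightarrow> 0) (at t within I)"
  proof (rule tendsto_sandwich[OF _ _ tendsto_const])
    show "((\<lambda>\<tau>. wiener_norm 2 (?dv \<tau>) + wiener_norm 2 (?dw \<tau>)) \<longlongrightarrow> 0) (at t within I)"
      using v w t by (intro tendsto_add_zero) (auto simp: wiener_path_def)
  qed (use eventually_at_within_mem[of I t] in \<open>auto elim!: eventually_mono simp: le wiener_norm_nonneg\<close>)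
qed

lemma wiener_path_continuous_norm:
  assumes w: "wiener_path I w" and r: "r \<le> 2"
  shows "continuous_on I (\<lambda>t. wiener_norm r (w t))"
  unfolding continuous_on_def
proof
  fix t assume t: "t \<in> I"
  have le: "\<bar>wiener_norm r (w \<tau>) - wiener_norm r (w t)\<bar> \<le> wiener_norm 2 (\<lambda>x. w \<tau> x - w t x)" if \<tau>: "\<tau> \<in> I" for \<tau>
  proof -
    note m = wiener_space_mono(1)[OF wiener_pathD[OF w t] r] wiener_space_mono(1)[OF wiener_pathD[OF w \<tau>] r]
    note d = wiener_space_diff(1)[OF m(2,1)]
    have "wiener_norm r (w \<tau>) \<le> wiener_norm r (\<lambda>x. w \<tau> x - w t x) + wiener_norm r (w t)"
      using wiener_space_add(2)[OF d m(1)] by simp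
    moreover have "wiener_norm r (w t) \<le> wiener_norm r (w \<tau>) + wiener_norm r (\<lambda>x. w \<tau> x - w t x)"
      using wiener_space_diff(2)[OF m(2) d] by simp
    moreover have "wiener_norm r (\<lambda>x. w \<tau> x - w t x) \<le> wiener_norm 2 (\<lambda>x. w \<tau> x - w t x)"
      by (rule wiener_space_mono(2)[OF wiener_space_diff(1)[OF wiener_pathD[OF w \<tau>] wiener_pathD[OF w t]] r])
    ultimately show ?thesis by linarith
  qed
  have "((\<lambda>\<tau>. wiener_norm r (w \<tau>) - wiener_norm r (w t)) \<longlongrightarrow> 0) (at t within I)"
  proof (rule Lim_null_comparison)
    show "((\<lambda>\<tau>. wiener_norm 2 (\<lambda>x. w \<tau> x - w t x)) \<longlongrightarrow> 0) (at t within I)"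
      using w t by (auto simp: wiener_path_def)
  qed (use eventually_at_within_mem[of I t] in \<open>auto elim!: eventually_mono simp: le\<close>)
  thus "((\<lambda>t. wiener_norm r (w t)) \<longlongrightarrow> wiener_norm r (w t)) (at t within I)"
    by (simp add: LIM_zero_iff)
qed

text \<open>
  Continuity in time with respect to the supremum norm, together with continuity in space, gives joint
  continuity.
\<close>

lemma continuous_on_prod_sup:
  fixes G :: "real \<Rightarrow> real ^ 'd \<Rightarrow> complex"
  assumes cont: "\<And>t. t \<in> I \<Longrightarrow> continuous_on UNIV (G t)"
    and le: "\<And>t \<tau> x. t \<in> I \<Longrightarrow> \<tau> \<in> I \<Longrightarrow> norm (G \<tau> x - G t x) \<le> N t \<tau>"
    and N: "\<And>t. t \<in> I \<Longrightarrow> (N t \<longlongrightarrow> 0) (at t within I)"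
  shows "continuous_on (I \<times> S) (\<lambda>(t, x). G t x)"
  unfolding continuous_on_iff
proof (intro ballI allI impI)
  fix p e assume p: "p \<in> I \<times> S" and e: "e > (0::real)"
  obtain t x where tx: "p = (t, x)" "t \<in> I" using p by auto
  obtain d1 where d1: "d1 > 0" "\<And>\<tau>. \<tau> \<in> I \<Longrightarrow> \<tau> \<noteq> t \<Longrightarrow> dist \<tau> t < d1 \<Longrightarrow> \<bar>N t \<tau>\<bar> < e / 2"
    using tendstoD[OF N[OF tx(2)], of "e / 2"] e by (auto simp: eventually_at)
  obtain d2 where d2: "d2 > 0" "\<And>y. dist y x < d2 \<Longrightarrow> dist (G t y) (G t x) < e / 2"
    using cont[OF tx(2)] e unfolding continuous_on_iff by (metis UNIV_I half_gt_zero)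
  show "\<exists>d>0. \<forall>q\<in>I \<times> S. dist q p < d \<longrightarrow> dist (case q of (t, x) \<Rightarrow> G t x) (case p of (t, x) \<Rightarrow> G t x) < e"
  proof (intro exI[of _ "min d1 d2"] conjI ballI impI)
    fix q assume q: "q \<in> I \<times> S" and d: "dist q p < min d1 d2"
    obtain \<tau> y where \<tau>: "q = (\<tau>, y)" "\<tau> \<in> I" using q by auto
    have "dist \<tau> t < d1" "dist y x < d2"
      using d dist_fst_le[of q p] dist_snd_le[of q p] by (auto simp: \<tau> tx)
    hence 2: "dist (G t y) (G t x) < e / 2" using d2 by simp
    have 1: "dist (G \<tau> y) (G t y) < e / 2"
      using le[OF tx(2) \<tau>(2), of y] d1(2)[OF \<tau>(2)] \<open>dist \<tau> t < d1\<close> e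
      by (cases "\<tau> = t") (auto simp: dist_norm)
    show "dist (case q of (t, x) \<Rightarrow> G t x) (case p of (t, x) \<Rightarrow> G t x) < e"
      using dist_triangle[of "G \<tau> y" "G t x" "G t y"] 1 2 by (simp add: \<tau> tx)
  qed (use d1 d2 in auto)
qed

lemma wiener_path_jointly_continuous:
  assumes w: "wiener_path I w"
  shows "continuous_on (I \<times> S) (\<lambda>(t, x). w t x)" "continuous_on (I \<times> S) (\<lambda>(t, x). laplacian (w t) x)"
proof -
  note 2 = numeral_2_eq_2
  have N: "((\<lambda>\<tau>. wiener_norm 2 (\<lambda>x. w \<tau> x - w t x)) \<longlongrightarrow> 0) (at t within I)" if "t \<in> I" for t
    using w that by (auto simp: wiener_path_def)
  have d: "(\<lambda>x. w \<tau> x - w t x) \<in> wiener_space 2" if "t \<in> I" "\<tau> \<in> I" for t \<tau>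
    by (rule wiener_space_diff(1)[OF wiener_pathD[OF w that(2)] wiener_pathD[OF w that(1)]])
  show "continuous_on (I \<times> S) (\<lambda>(t, x). w t x)"
    by (rule continuous_on_prod_sup[OF _ _ N]) (use wiener_spaceD(2)[OF wiener_pathD[OF w]] norm_le_wiener_norm[OF d] in auto)
  show "continuous_on (I \<times> S) (\<lambda>(t, x). laplacian (w t) x)"
  proof (rule continuous_on_prod_sup[OF _ _ N])
    show "continuous_on UNIV (laplacian (w t))" if "t \<in> I" for t
      using wiener_spaceD(2)[OF laplacian_wiener_space(2)[OF wiener_pathD[OF w that, unfolded 2]]] .
    fix t \<tau> x assume t: "t \<in> I" "\<tau> \<in> I"
    have "norm (laplacian (\<lambda>x. w \<tau> x - w t x) x) \<le> wiener_norm 0 (laplacian (\<lambda>x. w \<tau> x - w t x))"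
      by (rule norm_le_wiener_norm[OF laplacian_wiener_space(2)[OF d[OF t, unfolded 2]]])
    also have "\<dots> \<le> wiener_norm (Suc 0) (\<lambda>x. w \<tau> x - w t x)"
      by (rule laplacian_wiener_space(3)[OF d[OF t, unfolded 2]])
    also have "\<dots> \<le> wiener_norm 2 (\<lambda>x. w \<tau> x - w t x)"
      by (rule wiener_space_mono(2)[OF d[OF t]]) simp
    finally show "norm (laplacian (w \<tau>) x - laplacian (w t) x) \<le> wiener_norm 2 (\<lambda>x. w \<tau> x - w t x)"
      using laplacian_diff[OF wiener_pathD[OF w t(2), unfolded 2] wiener_pathD[OF w t(1), unfolded 2]] by simp
  qed
qed

section \<open>Duhamel's principle for Fourier coefficients\<close>

definition cubic :: "(real ^ 'd \<Rightarrow> complex) \<Rightarrow> (real ^ 'd \<Rightarrow> complex) \<Rightarrow> real ^ 'd \<Rightarrow> complex" where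
  "cubic p w x = p x * cnj (p x) * w x"

text \<open>
  Differentiation under the integral sign, which is justified by the joint continuity of the time derivative,
  turns the equation into an infinite system of ordinary differential equations.
\<close>

lemma fourier_coeff_schroedinger:
  fixes w :: "real \<Rightarrow> real ^ 'd \<Rightarrow> complex"
  assumes sol: "schroedinger_solution s lam {a..b} p w"
    and p: "wiener_path {a..b} p" and w: "wiener_path {a..b} w" and t: "t \<in> {a..b}"
  shows "((\<lambda>\<tau>. fourier_coeff (w \<tau>) m) has_vector_derivative
    - \<i> * (of_real (freq_sq m) * fourier_coeff (w t) m + of_real lam * fourier_coeff (cubic (p t) (w t)) m))
    (at t within {a..b})"
proof -
  define D where "D \<tau> x = - \<i> * (- laplacian (w \<tau>) x + of_real lam * cubic (p \<tau>) (w \<tau>) x)" for \<tau> x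
  define c where "c = complex_of_real (1 / (2 * pi) ^ CARD('d))"
  have der: "((\<lambda>\<tau>. w \<tau> x) has_vector_derivative D \<tau> x) (at \<tau> within {a..b})" if "\<tau> \<in> {a..b}" for \<tau> x
  proof -
    obtain E where E: "((\<lambda>\<tau>. w \<tau> x) has_vector_derivative E) (at \<tau> within {a..b})"
      "\<i> * E = - laplacian (w \<tau>) x + of_real (lam * (cmod (p \<tau> x))\<^sup>2) * w \<tau> x"
      using sol \<open>\<tau> \<in> {a..b}\<close> unfolding schroedinger_solution_def by blast
    have "E = - \<i> * (\<i> * E)" by simp
    also have "\<dots> = D \<tau> x"
      unfolding E(2) D_def by (simp add: cubic_def complex_norm_square[symmetric] mult_ac)
    finally show ?thesis using E(1) by simp
  qed
  have contw: "continuous_on UNIV (w \<tau>)" if "\<tau> \<in> {a..b}" for \<tau>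
    by (rule wiener_spaceD(2)[OF wiener_pathD[OF w that]])
  have contp: "continuous_on UNIV (p \<tau>)" if "\<tau> \<in> {a..b}" for \<tau>
    by (rule wiener_spaceD(2)[OF wiener_pathD[OF p that]])
  have contc: "continuous_on UNIV (cubic (p t) (w t))"
    unfolding cubic_def[abs_def] by (intro continuous_intros contw contp t)
  have contl: "continuous_on UNIV (laplacian (w t))"
    using wiener_spaceD(2)[OF laplacian_wiener_space(2)[OF wiener_pathD[OF w t, unfolded numeral_2_eq_2]]] .
  have contD: "continuous_on UNIV (D t)"
    unfolding D_def[abs_def] by (intro continuous_intros contl contc)
  have fc: "fourier_coeff f m = c * integral (cbox 0 (\<chi> i. 2 * pi)) (\<lambda>x. f x * character (- m) x)"
    if "continuous_on UNIV f" for f :: "real ^ 'd \<Rightarrow> complex"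
    unfolding fourier_coeff_character
    by (subst torus_mean_eq_integral) 
       (auto simp: c_def torus_cell_def scaleR_conv_of_real intro!: continuous_intros that)
  have "((\<lambda>\<tau>. integral (cbox 0 (\<chi> i. 2 * pi)) (\<lambda>x. w \<tau> x * character (- m) x)) has_vector_derivative
      integral (cbox 0 (\<chi> i. 2 * pi)) (\<lambda>x. D t x * character (- m) x)) (at t within {a..b})"
  proof (rule leibniz_rule_vector_derivative)
    show "((\<lambda>\<tau>. w \<tau> x * character (- m) x) has_vector_derivative D \<tau> x * character (- m) x) (at \<tau> within {a..b})"
      if "\<tau> \<in> {a..b}" for \<tau> x
      using has_vector_derivative_mult_left[OF der[OF that]] by simp
    show "(\<lambda>x. w \<tau> x * character (- m) x) integrable_on cbox 0 (\<chi> i. 2 * pi)" if "\<tau> \<in> {a..b}" for \<tau>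
      by (intro integrable_continuous continuous_intros continuous_on_subset[OF contw[OF that]]) simp
    have jc: "continuous_on ({a..b} \<times> cbox 0 (\<chi> i. 2 * pi)) (\<lambda>z. character (- m) (snd z))"
      by (rule continuous_on_compose2[OF continuous_character[of UNIV]]) (auto intro!: continuous_intros)
    show "continuous_on ({a..b} \<times> cbox 0 (\<chi> i. 2 * pi)) (\<lambda>(\<tau>, x). D \<tau> x * character (- m) x)"
      unfolding D_def cubic_def case_prod_beta
      using wiener_path_jointly_continuous[OF w, unfolded case_prod_beta]
        wiener_path_jointly_continuous(1)[OF p, unfolded case_prod_beta]
      by (intro continuous_intros jc)
  qed (use t in auto)
  hence "((\<lambda>\<tau>. c * integral (cbox 0 (\<chi> i. 2 * pi)) (\<lambda>x. w \<tau> x * character (- m) x)) has_vector_derivative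
      c * integral (cbox 0 (\<chi> i. 2 * pi)) (\<lambda>x. D t x * character (- m) x)) (at t within {a..b})"
    by (rule has_vector_derivative_mult_right)
  hence "((\<lambda>\<tau>. fourier_coeff (w \<tau>) m) has_vector_derivative fourier_coeff (D t) m) (at t within {a..b})"
    unfolding fc[OF contD, symmetric]
    by (rule has_vector_derivative_transform[OF t, rotated]) (simp add: fc contw)
  moreover have "fourier_coeff (D t) m
      = - \<i> * (of_real (freq_sq m) * fourier_coeff (w t) m + of_real lam * fourier_coeff (cubic (p t) (w t)) m)"
  proof -
    have "fourier_coeff (D t) m = fourier_coeff (\<lambda>x. - \<i> * (of_real lam * cubic (p t) (w t) x - laplacian (w t) x)) m"
      by (simp add: D_def[abs_def] algebra_simps)
    also have "\<dots> = - \<i> * (of_real lam * fourier_coeff (cubic (p t) (w t)) m - fourier_coeff (laplacian (w t)) m)"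
      unfolding fourier_coeff_cmult by (subst fourier_coeff_diff) (auto simp: fourier_coeff_cmult intro!: continuous_intros contc contl)
    also have "fourier_coeff (laplacian (w t)) m = - of_real (freq_sq m) * fourier_coeff (w t) m"
      by (rule laplacian_wiener_space(1)[OF wiener_pathD[OF w t, unfolded numeral_2_eq_2]])
    finally show ?thesis by (simp add: algebra_simps)
  qed
  ultimately show ?thesis by simp
qed

text \<open>
  The mean value inequality in a finite-dimensional weighted \<open>\<ell>\<^sup>1\<close> space.  Pairing with the phases of
  the components of the increment reduces it to a single complex-valued function.  Working with finite index sets
  and one bound for all of them avoids integrating norms in time.
\<close>

lemma weighted_increment_le:
  fixes \<phi> :: "real \<Rightarrow> 'a \<Rightarrow> complex"
  assumes F: "finite F" and \<omega>: "\<And>m. m \<in> F \<Longrightarrow> \<omega> m \<ge> 0"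
    and der: "\<And>t m. t \<in> {a..b} \<Longrightarrow> m \<in> F \<Longrightarrow> ((\<lambda>\<tau>. \<phi> \<tau> m) has_vector_derivative \<phi>' t m) (at t within {a..b})"
    and bound: "\<And>t. t \<in> {a..b} \<Longrightarrow> (\<Sum>m\<in>F. \<omega> m * norm (\<phi>' t m)) \<le> G"
    and t: "t \<in> {a..b}"
  shows "(\<Sum>m\<in>F. \<omega> m * norm (\<phi> t m - \<phi> a m)) \<le> (t - a) * G"
proof -
  \<comment> \<open>chosen such that \<open>c m\<close> rotates the increment of the component \<open>m\<close> onto its modulus\<close>
  define c where "c m = cnj (sgn (\<phi> t m - \<phi> a m))" for m
  have c1: "norm (c m) \<le> 1" for m by (simp add: c_def norm_sgn)
  have cz: "c m * (\<phi> t m - \<phi> a m) = of_real (norm (\<phi> t m - \<phi> a m))" for m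
  proof -
    have "c m * (\<phi> t m - \<phi> a m) = of_real (inverse (norm (\<phi> t m - \<phi> a m))) * ((\<phi> t m - \<phi> a m) * cnj (\<phi> t m - \<phi> a m))"
      by (simp only: c_def sgn_div_norm scaleR_conv_of_real complex_cnj_mult complex_cnj_complex_of_real mult_ac)
    thus ?thesis
      unfolding complex_norm_square[symmetric] by (cases "\<phi> t m = \<phi> a m") (simp_all add: power2_eq_square)
  qed
  define \<psi> where "\<psi> \<tau> = (\<Sum>m\<in>F. of_real (\<omega> m) * c m * \<phi> \<tau> m)" for \<tau>
  define \<psi>' where "\<psi>' \<tau> = (\<Sum>m\<in>F. of_real (\<omega> m) * c m * \<phi>' \<tau> m)" for \<tau>
  have "norm (\<psi> t - \<psi> a) \<le> G * norm (t - a)"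
  proof (rule differentiable_bound[of "{a..b}"])
    fix \<tau> assume \<tau>: "\<tau> \<in> {a..b}"
    have "(\<psi> has_vector_derivative \<psi>' \<tau>) (at \<tau> within {a..b})"
      unfolding \<psi>_def[abs_def] \<psi>'_def
      by (intro has_vector_derivative_sum has_vector_derivative_mult_right der \<tau>)
    thus "(\<psi> has_derivative (\<lambda>h. h *\<^sub>R \<psi>' \<tau>)) (at \<tau> within {a..b})"
      by (simp add: has_vector_derivative_def)
    have "norm (\<psi>' \<tau>) \<le> (\<Sum>m\<in>F. \<omega> m * norm (\<phi>' \<tau> m))"
      unfolding \<psi>'_def
    proof (rule sum_norm_le)
      fix m assume m: "m \<in> F"
      have "\<omega> m * norm (c m) * norm (\<phi>' \<tau> m) \<le> \<omega> m * 1 * norm (\<phi>' \<tau> m)"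
        using \<omega>[OF m] c1 by (intro mult_left_mono mult_right_mono) auto
      thus "norm (of_real (\<omega> m) * c m * \<phi>' \<tau> m) \<le> \<omega> m * norm (\<phi>' \<tau> m)"
        using \<omega>[OF m] by (simp add: norm_mult)
    qed
    also have "\<dots> \<le> G" by (rule bound[OF \<tau>])
    finally show "onorm (\<lambda>h. h *\<^sub>R \<psi>' \<tau>) \<le> G"
      by (intro onorm_le) (simp add: mult.commute[of G] mult_left_mono)
  qed (use t in auto)
  moreover have "\<psi> t - \<psi> a = of_real (\<Sum>m\<in>F. \<omega> m * norm (\<phi> t m - \<phi> a m))"
  proof -
    have "\<psi> t - \<psi> a = (\<Sum>m\<in>F. of_real (\<omega> m) * (c m * (\<phi> t m - \<phi> a m)))"
      by (simp add: \<psi>_def sum_subtractf[symmetric] algebra_simps)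
    thus ?thesis by (simp add: cz)
  qed
  moreover have "(\<Sum>m\<in>F. \<omega> m * norm (\<phi> t m - \<phi> a m)) \<ge> 0"
    using \<omega> by (intro sum_nonneg) simp
  ultimately have "(\<Sum>m\<in>F. \<omega> m * norm (\<phi> t m - \<phi> a m)) \<le> G * norm (t - a)"
    by (simp only: norm_of_real abs_of_nonneg)
  thus ?thesis using t by (simp add: mult.commute)
qed

lemma finite_sum_le_wiener_norm:
  assumes "v \<in> wiener_space r" "finite F"
  shows "(\<Sum>m\<in>F. freq_weight m ^ r * norm (fourier_coeff v m)) \<le> wiener_norm r v"
  unfolding wiener_norm_def
  by (rule finite_sum_le_infsum[OF wiener_spaceD(3)[OF assms(1)] assms(2)]) auto

lemma wiener_norm_le_finite:
  assumes "v \<in> wiener_space r"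
    and "\<And>F. finite F \<Longrightarrow> (\<Sum>m\<in>F. freq_weight m ^ r * norm (fourier_coeff v m)) \<le> C"
  shows "wiener_norm r v \<le> C"
  unfolding wiener_norm_def
  by (rule infsum_le_finite_sums[OF wiener_spaceD(3)[OF assms(1)] assms(2)])

text \<open>
  The factor \<open>exp (\<i> |m|\<^sup>2 t)\<close> has modulus one and removes the term with the unbounded factor \<open>|m|\<^sup>2\<close>, so that
  only \<open>g\<close> contributes to the growth of the norm.
\<close>

lemma duhamel_estimate:
  fixes e g :: "real \<Rightarrow> real ^ 'd \<Rightarrow> complex"
  assumes e: "\<And>t. t \<in> {a..b} \<Longrightarrow> e t \<in> wiener_space r"
    and g: "\<And>t. t \<in> {a..b} \<Longrightarrow> g t \<in> wiener_space r" "\<And>t. t \<in> {a..b} \<Longrightarrow> wiener_norm r (g t) \<le> G"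
    and der: "\<And>t m. t \<in> {a..b} \<Longrightarrow> ((\<lambda>\<tau>. fourier_coeff (e \<tau>) m) has_vector_derivative
       - \<i> * (of_real (freq_sq m) * fourier_coeff (e t) m + fourier_coeff (g t) m)) (at t within {a..b})"
    and t: "t \<in> {a..b}"
  shows "wiener_norm r (e t) \<le> wiener_norm r (e a) + (t - a) * G"
proof (rule wiener_norm_le_finite[OF e[OF t]])
  fix F :: "(int ^ 'd) set" assume F: "finite F"
  have a: "a \<in> {a..b}" using t by simp
  define \<phi> where "\<phi> \<tau> m = exp (\<i> * of_real (freq_sq m) * of_real \<tau>) * fourier_coeff (e \<tau>) m" for \<tau> m
  define \<phi>' where "\<phi>' \<tau> m = - \<i> * exp (\<i> * of_real (freq_sq m) * of_real \<tau>) * fourier_coeff (g \<tau>) m" for \<tau> m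
  have n1: "norm (exp (\<i> * of_real (freq_sq m) * of_real \<tau>)) = 1" for m :: "int ^ 'd" and \<tau>
    by simp
  have "(\<Sum>m\<in>F. freq_weight m ^ r * norm (\<phi> t m - \<phi> a m)) \<le> (t - a) * G"
  proof (rule weighted_increment_le[OF F _ _ _ t])
    fix \<tau> and m :: "int ^ 'd" assume \<tau>: "\<tau> \<in> {a..b}"
    have "((\<lambda>\<tau>. exp (\<i> * of_real (freq_sq m) * of_real \<tau>)) has_vector_derivative
        exp (\<i> * of_real (freq_sq m) * of_real \<tau>) * (\<i> * of_real (freq_sq m))) (at \<tau> within {a..b})"
      by (rule has_vector_derivative_real_field) (auto intro!: derivative_eq_intros)
    from has_vector_derivative_mult[OF this der[OF \<tau>, of m]]
    show "((\<lambda>\<tau>. \<phi> \<tau> m) has_vector_derivative \<phi>' \<tau> m) (at \<tau> within {a..b})"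
      unfolding \<phi>_def \<phi>'_def by (simp add: algebra_simps)
  next
    fix \<tau> assume \<tau>: "\<tau> \<in> {a..b}"
    have "(\<Sum>m\<in>F. freq_weight m ^ r * norm (\<phi>' \<tau> m)) = (\<Sum>m\<in>F. freq_weight m ^ r * norm (fourier_coeff (g \<tau>) m))"
      unfolding \<phi>'_def norm_mult n1 by simp
    also have "\<dots> \<le> wiener_norm r (g \<tau>)" by (rule finite_sum_le_wiener_norm[OF g(1)[OF \<tau>] F])
    also have "\<dots> \<le> G" by (rule g(2)[OF \<tau>])
    finally show "(\<Sum>m\<in>F. freq_weight m ^ r * norm (\<phi>' \<tau> m)) \<le> G" .
  qed simp
  moreover have "(\<Sum>m\<in>F. freq_weight m ^ r * norm (fourier_coeff (e t) m))
      \<le> (\<Sum>m\<in>F. freq_weight m ^ r * norm (fourier_coeff (e a) m) + freq_weight m ^ r * norm (\<phi> t m - \<phi> a m))"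
  proof (rule sum_mono)
    fix m
    have "norm (\<phi> t m) \<le> norm (\<phi> a m) + norm (\<phi> t m - \<phi> a m)"
      using norm_triangle_ineq[of "\<phi> a m" "\<phi> t m - \<phi> a m"] by simp
    hence "norm (fourier_coeff (e t) m) \<le> norm (fourier_coeff (e a) m) + norm (\<phi> t m - \<phi> a m)"
      using n1 by (simp add: \<phi>_def norm_mult)
    thus "freq_weight m ^ r * norm (fourier_coeff (e t) m)
        \<le> freq_weight m ^ r * norm (fourier_coeff (e a) m) + freq_weight m ^ r * norm (\<phi> t m - \<phi> a m)"
      by (simp add: distrib_left[symmetric] mult_left_mono)
  qed
  moreover have "(\<Sum>m\<in>F. freq_weight m ^ r * norm (fourier_coeff (e a) m)) \<le> wiener_norm r (e a)"
    by (rule finite_sum_le_wiener_norm[OF e[OF a] F])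
  ultimately show "(\<Sum>m\<in>F. freq_weight m ^ r * norm (fourier_coeff (e t) m)) \<le> wiener_norm r (e a) + (t - a) * G"
    by (simp add: sum.distrib)
qed

lemma cubic_wiener_space:
  assumes p: "p \<in> wiener_space r" and w: "w \<in> wiener_space r"
  shows "cubic p w \<in> wiener_space r" "wiener_norm r (cubic p w) \<le> (wiener_norm r p)\<^sup>2 * wiener_norm r w"
proof -
  note pp = wiener_space_mult[OF p wiener_space_cnj(1)[OF p]]
  show "cubic p w \<in> wiener_space r"
    unfolding cubic_def[abs_def] by (rule wiener_space_mult(1)[OF pp(1) w])
  have "wiener_norm r (cubic p w) \<le> wiener_norm r (\<lambda>x. p x * cnj (p x)) * wiener_norm r w"
    unfolding cubic_def[abs_def] by (rule wiener_space_mult(2)[OF pp(1) w])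
  also have "\<dots> \<le> (wiener_norm r p)\<^sup>2 * wiener_norm r w"
    using pp(2) by (intro mult_right_mono wiener_norm_nonneg) (simp add: wiener_space_cnj(2)[OF p] power2_eq_square)
  finally show "wiener_norm r (cubic p w) \<le> (wiener_norm r p)\<^sup>2 * wiener_norm r w" .
qed

text \<open>
  From \<open>|p|\<^sup>2 w - |q|\<^sup>2 u = |p|\<^sup>2 (w - u) + (p \<cdot> cnj (p - q) + (p - q) \<cdot> cnj q) u\<close>.
\<close>

lemma cubic_diff_wiener_norm:
  assumes p: "p \<in> wiener_space r" and w: "w \<in> wiener_space r" and q: "q \<in> wiener_space r" and u: "u \<in> wiener_space r"
  shows "wiener_norm r (\<lambda>x. cubic p w x - cubic q u x) \<le>
    (wiener_norm r p)\<^sup>2 * wiener_norm r (\<lambda>x. w x - u x)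
    + (wiener_norm r p + wiener_norm r q) * wiener_norm r (\<lambda>x. p x - q x) * wiener_norm r u"
proof -
  let ?d = "\<lambda>x. p x - q x"
  note d = wiener_space_diff(1)[OF p q]
  note d' = wiener_space_cnj[OF d]
  note wu = wiener_space_diff(1)[OF w u]
  note a = wiener_space_mult[OF p d'(1)] and b = wiener_space_mult[OF d wiener_space_cnj(1)[OF q]]
  note ab = wiener_space_add[OF a(1) b(1)]
  note abu = wiener_space_mult[OF ab(1) u]
  note c = cubic_wiener_space[OF p wu]
  have eq: "(\<lambda>x. cubic p w x - cubic q u x)
      = (\<lambda>x. cubic p (\<lambda>x. w x - u x) x + (p x * cnj (?d x) + ?d x * cnj (q x)) * u x)"
    by (simp add: cubic_def algebra_simps)
  have "wiener_norm r (\<lambda>x. p x * cnj (?d x) + ?d x * cnj (q x))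
      \<le> (wiener_norm r p + wiener_norm r q) * wiener_norm r ?d"
    using ab(2) a(2) b(2) unfolding d'(2) wiener_space_cnj(2)[OF q] by (simp add: algebra_simps)
  hence "wiener_norm r (\<lambda>x. p x * cnj (?d x) + ?d x * cnj (q x)) * wiener_norm r u
      \<le> (wiener_norm r p + wiener_norm r q) * wiener_norm r ?d * wiener_norm r u"
    by (rule mult_right_mono) (rule wiener_norm_nonneg)
  thus ?thesis
    unfolding eq using wiener_space_add(2)[OF c(1) abu(1)] abu(2) c(2) by linarith
qed

section \<open>Stability of the iteration\<close>

lemma wiener_path_1: "wiener_path I w \<Longrightarrow> t \<in> I \<Longrightarrow> w t \<in> wiener_space 1"
  by (rule wiener_space_mono(1)[OF wiener_pathD]) auto

text \<open>
  On a short interval the term proportional to \<open>e\<close> is absorbed: at a time where the norm of \<open>e\<close> attains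
  its maximum, it contributes at most half of that maximum.
\<close>

lemma linear_stability:
  fixes e g :: "real \<Rightarrow> real ^ 'd \<Rightarrow> complex"
  assumes e: "wiener_path {a..b} e"
    and g: "\<And>t. t \<in> {a..b} \<Longrightarrow> g t \<in> wiener_space 1"
      "\<And>t. t \<in> {a..b} \<Longrightarrow> wiener_norm 1 (g t) \<le> \<alpha> * wiener_norm 1 (e t) + \<beta>"
    and der: "\<And>t m. t \<in> {a..b} \<Longrightarrow> ((\<lambda>\<tau>. fourier_coeff (e \<tau>) m) has_vector_derivative
       - \<i> * (of_real (freq_sq m) * fourier_coeff (e t) m + fourier_coeff (g t) m)) (at t within {a..b})"
    and pos: "\<alpha> \<ge> 0" "\<beta> \<ge> 0" and small: "(b - a) * \<alpha> \<le> 1 / 2" and t: "t \<in> {a..b}"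
  shows "wiener_norm 1 (e t) \<le> 2 * (wiener_norm 1 (e a) + (b - a) * \<beta>)"
proof -
  obtain t' where t': "t' \<in> {a..b}" "\<And>\<tau>. \<tau> \<in> {a..b} \<Longrightarrow> wiener_norm 1 (e \<tau>) \<le> wiener_norm 1 (e t')"
    using continuous_attains_sup[of "{a..b}" "\<lambda>t. wiener_norm 1 (e t)"] t wiener_path_continuous_norm[OF e, of 1] by auto
  define M where "M = wiener_norm 1 (e t')"
  have M: "M \<ge> 0" by (simp add: M_def wiener_norm_nonneg)
  have "M \<le> wiener_norm 1 (e a) + (t' - a) * (\<alpha> * M + \<beta>)"
    unfolding M_def
  proof (rule duhamel_estimate[where g = g and b = b])
    show "wiener_norm 1 (g \<tau>) \<le> \<alpha> * wiener_norm 1 (e t') + \<beta>" if \<tau>: "\<tau> \<in> {a..b}" for \<tau>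
      using g(2)[OF \<tau>] mult_left_mono[OF t'(2)[OF \<tau>] pos(1)] by linarith
  qed (use g der t' wiener_path_1[OF e] in auto)
  also have "(t' - a) * (\<alpha> * M + \<beta>) \<le> (b - a) * (\<alpha> * M + \<beta>)"
    using t' pos M by (intro mult_right_mono) auto
  also have "(b - a) * (\<alpha> * M + \<beta>) \<le> M / 2 + (b - a) * \<beta>"
    using mult_right_mono[OF small M] by (simp add: algebra_simps)
  finally have "M \<le> 2 * (wiener_norm 1 (e a) + (b - a) * \<beta>)" by simp
  thus ?thesis using t'(2)[OF t] by (simp add: M_def)
qed

text \<open>
  On an interval that is short relative to the size of \<open>p\<close>, the bound refers to the initial value only, so it
  can be repeated along the iteration: if \<open>p\<close> lies in the ball of radius \<open>2R\<close> and the initial value in the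
  ball of radius \<open>R\<close>, then the next iterate lies in the ball of radius \<open>2R\<close> again.
\<close>

lemma linear_solution_bound:
  assumes sol: "schroedinger_solution s lam {a..b} p w"
    and p: "wiener_path {a..b} p" and w: "wiener_path {a..b} w"
    and P: "\<And>t. t \<in> {a..b} \<Longrightarrow> wiener_norm 1 (p t) \<le> P"
    and small: "(b - a) * (\<bar>lam\<bar> * P\<^sup>2) \<le> 1 / 2" and t: "t \<in> {a..b}"
  shows "wiener_norm 1 (w t) \<le> 2 * wiener_norm 1 (w a)"
proof -
  have "wiener_norm 1 (w t) \<le> 2 * (wiener_norm 1 (w a) + (b - a) * 0)"
  proof (rule linear_stability[OF w _ _ _ _ _ small t, where g = "\<lambda>t x. of_real lam * cubic (p t) (w t) x"])
    fix \<tau> assume \<tau>: "\<tau> \<in> {a..b}"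
    note c = cubic_wiener_space[OF wiener_path_1[OF p \<tau>] wiener_path_1[OF w \<tau>]]
    show "(\<lambda>x. of_real lam * cubic (p \<tau>) (w \<tau>) x) \<in> wiener_space 1"
      by (rule wiener_space_cmult(1)[OF c(1)])
    have "wiener_norm 1 (\<lambda>x. of_real lam * cubic (p \<tau>) (w \<tau>) x) \<le> \<bar>lam\<bar> * wiener_norm 1 (cubic (p \<tau>) (w \<tau>))"
      using wiener_space_cmult(2)[OF c(1), of "of_real lam"] by simp
    also have "\<dots> \<le> \<bar>lam\<bar> * (P\<^sup>2 * wiener_norm 1 (w \<tau>))"
      using P[OF \<tau>] wiener_norm_nonneg
      by (intro mult_left_mono order_trans[OF c(2)] mult_right_mono power_mono) auto
    finally show "wiener_norm 1 (\<lambda>x. of_real lam * cubic (p \<tau>) (w \<tau>) x) \<le> \<bar>lam\<bar> * P\<^sup>2 * wiener_norm 1 (w \<tau>) + 0"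
      by simp
    show "((\<lambda>\<tau>. fourier_coeff (w \<tau>) m) has_vector_derivative
        - \<i> * (of_real (freq_sq m) * fourier_coeff (w \<tau>) m + fourier_coeff (\<lambda>x. of_real lam * cubic (p \<tau>) (w \<tau>) x) m))
        (at \<tau> within {a..b})" for m
      unfolding fourier_coeff_cmult by (rule fourier_coeff_schroedinger[OF sol p w \<tau>])
  qed auto
  thus ?thesis by simp
qed

text \<open>
  The error starts from \<open>0\<close> and is driven by \<open>\<lambda>(|p|\<^sup>2 - |u|\<^sup>2) u\<close>, whose norm is at most
  \<open>3|\<lambda>|R\<^sup>2 E\<close>; the absorption in \<open>linear_stability\<close> doubles this constant.
\<close>

lemma linearisation_error_step:
  assumes sol: "schroedinger_solution s lam {a..b} p w" and nls: "schroedinger_solution s lam {a..b} u u"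
    and init: "w a = u a"
    and p: "wiener_path {a..b} p" and w: "wiener_path {a..b} w" and u: "wiener_path {a..b} u"
    and P: "\<And>t. t \<in> {a..b} \<Longrightarrow> wiener_norm 1 (p t) \<le> 2 * R"
    and U: "\<And>t. t \<in> {a..b} \<Longrightarrow> wiener_norm 1 (u t) \<le> R"
    and E: "\<And>t. t \<in> {a..b} \<Longrightarrow> wiener_norm 1 (\<lambda>x. p t x - u t x) \<le> E"
    and small: "(b - a) * (\<bar>lam\<bar> * (2 * R)\<^sup>2) \<le> 1 / 2" and t: "t \<in> {a..b}"
  shows "wiener_norm 1 (\<lambda>x. w t x - u t x) \<le> (b - a) * (6 * \<bar>lam\<bar> * R\<^sup>2) * E"
proof -
  have R: "R \<ge> 0" using U[OF t] wiener_norm_nonneg[of 1 "u t"] by linarith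
  have E0: "E \<ge> 0" using E[OF t] wiener_norm_nonneg[of 1 "\<lambda>x. p t x - u t x"] by linarith
  let ?e = "\<lambda>t x. w t x - u t x"
  let ?g = "\<lambda>t x. of_real lam * (cubic (p t) (w t) x - cubic (u t) (u t) x)"
  have "wiener_norm 1 (?e t) \<le> 2 * (wiener_norm 1 (?e a) + (b - a) * (\<bar>lam\<bar> * (3 * R\<^sup>2 * E)))"
  proof (rule linear_stability[OF wiener_path_diff[OF w u] _ _ _ _ _ small t, where g = ?g])
    fix \<tau> assume \<tau>: "\<tau> \<in> {a..b}"
    note p1 = wiener_path_1[OF p \<tau>] and w1 = wiener_path_1[OF w \<tau>] and u1 = wiener_path_1[OF u \<tau>]
    note cp = cubic_wiener_space(1)[OF p1 w1] and cu = cubic_wiener_space(1)[OF u1 u1]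
    note d = wiener_space_diff(1)[OF cp cu]
    show "?g \<tau> \<in> wiener_space 1" by (rule wiener_space_cmult(1)[OF d])
    have "(wiener_norm 1 (p \<tau>))\<^sup>2 * wiener_norm 1 (?e \<tau>) \<le> (2 * R)\<^sup>2 * wiener_norm 1 (?e \<tau>)"
      using P[OF \<tau>] by (intro mult_right_mono power_mono wiener_norm_nonneg) auto
    moreover have "(wiener_norm 1 (p \<tau>) + wiener_norm 1 (u \<tau>)) * wiener_norm 1 (\<lambda>x. p \<tau> x - u \<tau> x) * wiener_norm 1 (u \<tau>)
        \<le> (2 * R + R) * E * R"
      using P[OF \<tau>] U[OF \<tau>] E[OF \<tau>] R E0 by (intro mult_mono add_mono) (auto intro!: wiener_norm_nonneg add_nonneg_nonneg mult_nonneg_nonneg)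
    ultimately have "wiener_norm 1 (\<lambda>x. cubic (p \<tau>) (w \<tau>) x - cubic (u \<tau>) (u \<tau>) x)
        \<le> (2 * R)\<^sup>2 * wiener_norm 1 (?e \<tau>) + 3 * R\<^sup>2 * E"
      using cubic_diff_wiener_norm[OF p1 w1 u1 u1] by (simp add: power2_eq_square algebra_simps)
    hence "\<bar>lam\<bar> * wiener_norm 1 (\<lambda>x. cubic (p \<tau>) (w \<tau>) x - cubic (u \<tau>) (u \<tau>) x)
        \<le> \<bar>lam\<bar> * ((2 * R)\<^sup>2 * wiener_norm 1 (?e \<tau>) + 3 * R\<^sup>2 * E)"
      by (rule mult_left_mono) simp
    thus "wiener_norm 1 (?g \<tau>) \<le> \<bar>lam\<bar> * (2 * R)\<^sup>2 * wiener_norm 1 (?e \<tau>) + \<bar>lam\<bar> * (3 * R\<^sup>2 * E)"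
      using wiener_space_cmult(2)[OF d, of "of_real lam"] by (simp add: algebra_simps)
    fix m
    have fe: "fourier_coeff (?e \<tau>) m = fourier_coeff (w \<tau>) m - fourier_coeff (u \<tau>) m" if "\<tau> \<in> {a..b}" for \<tau>
      using wiener_spaceD(2)[OF wiener_path_1[OF w that]] wiener_spaceD(2)[OF wiener_path_1[OF u that]]
      by (rule fourier_coeff_diff)
    have fg: "fourier_coeff (?g \<tau>) m = of_real lam * (fourier_coeff (cubic (p \<tau>) (w \<tau>)) m - fourier_coeff (cubic (u \<tau>) (u \<tau>)) m)"
      unfolding fourier_coeff_cmult
      by (simp only: fourier_coeff_diff[OF wiener_spaceD(2)[OF cp] wiener_spaceD(2)[OF cu]])
    have "((\<lambda>\<tau>. fourier_coeff (w \<tau>) m - fourier_coeff (u \<tau>) m) has_vector_derivative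
       - \<i> * (of_real (freq_sq m) * fourier_coeff (?e \<tau>) m + fourier_coeff (?g \<tau>) m)) (at \<tau> within {a..b})"
      using has_vector_derivative_diff[OF fourier_coeff_schroedinger[OF sol p w \<tau>, of m]
          fourier_coeff_schroedinger[OF nls u u \<tau>, of m]]
      unfolding fe[OF \<tau>] fg by (simp add: algebra_simps)
    thus "((\<lambda>\<tau>. fourier_coeff (?e \<tau>) m) has_vector_derivative
       - \<i> * (of_real (freq_sq m) * fourier_coeff (?e \<tau>) m + fourier_coeff (?g \<tau>) m)) (at \<tau> within {a..b})"
      by (rule has_vector_derivative_transform[OF \<tau>, rotated]) (simp only: fe)
  qed (use E0 in auto)
  moreover have "wiener_norm 1 (?e a) = 0"
    by (simp add: init wiener_norm_def fourier_coeff_def torus_mean_def)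
  ultimately show ?thesis by (simp add: algebra_simps)
qed

text \<open>
  The error of the constant initial iterate.  Here the time derivative itself is
  estimated, and one factor of the weight is spent on \<open>\<Delta>u\<close>.
\<close>

lemma nls_increment_bound:
  fixes u :: "real \<Rightarrow> real ^ 'd \<Rightarrow> complex"
  assumes nls: "schroedinger_solution s lam {a..b} u u" and u: "wiener_path {a..b} u"
    and R: "\<And>t. t \<in> {a..b} \<Longrightarrow> wiener_norm 2 (u t) \<le> R" and t: "t \<in> {a..b}"
  shows "wiener_norm 1 (\<lambda>x. u t x - u a x) \<le> (t - a) * (R + \<bar>lam\<bar> * R ^ 3)"
proof -
  have a: "a \<in> {a..b}" using t by simp
  note ut = wiener_path_1[OF u t] and ua = wiener_path_1[OF u a]
  show ?thesis
  proof (rule wiener_norm_le_finite[OF wiener_space_diff(1)[OF ut ua]])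
    fix F :: "(int ^ 'd) set" assume F: "finite F"
    have "(\<Sum>m\<in>F. freq_weight m ^ 1 * norm (fourier_coeff (u t) m - fourier_coeff (u a) m))
        \<le> (t - a) * (R + \<bar>lam\<bar> * R ^ 3)"
    proof (rule weighted_increment_le[OF F _ fourier_coeff_schroedinger[OF nls u u] _ t])
      fix \<tau> assume \<tau>: "\<tau> \<in> {a..b}"
      note u1 = wiener_path_1[OF u \<tau>]
      note c = cubic_wiener_space[OF u1 u1]
      let ?f = "fourier_coeff (u \<tau>)" and ?c = "fourier_coeff (cubic (u \<tau>) (u \<tau>))"
      have R1: "wiener_norm 1 (u \<tau>) \<le> R"
        using wiener_space_mono(2)[OF wiener_pathD[OF u \<tau>], of 1] R[OF \<tau>] by simp
      have "wiener_norm 1 (cubic (u \<tau>) (u \<tau>)) \<le> wiener_norm 1 (u \<tau>) ^ 3"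
        using c(2) by (simp add: power2_eq_square power3_eq_cube mult_ac)
      also have "\<dots> \<le> R ^ 3" using R1 by (intro power_mono wiener_norm_nonneg)
      finally have c3: "wiener_norm 1 (cubic (u \<tau>) (u \<tau>)) \<le> R ^ 3" .
      have "(\<Sum>m\<in>F. freq_weight m ^ 1 * norm (- \<i> * (of_real (freq_sq m) * ?f m + of_real lam * ?c m)))
          \<le> (\<Sum>m\<in>F. freq_weight m ^ 2 * norm (?f m) + \<bar>lam\<bar> * (freq_weight m ^ 1 * norm (?c m)))"
      proof (rule sum_mono)
        fix m :: "int ^ 'd"
        have "norm (- \<i> * (of_real (freq_sq m) * ?f m + of_real lam * ?c m)) \<le> freq_sq m * norm (?f m) + \<bar>lam\<bar> * norm (?c m)"
          using norm_triangle_ineq[of "of_real (freq_sq m) * ?f m" "of_real lam * ?c m"] freq_sq_nonneg[of m]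
          by (simp add: norm_mult)
        also have "\<dots> \<le> freq_weight m * norm (?f m) + \<bar>lam\<bar> * norm (?c m)"
          by (intro add_right_mono mult_right_mono freq_sq_le_weight) simp
        finally have "freq_weight m * norm (- \<i> * (of_real (freq_sq m) * ?f m + of_real lam * ?c m))
            \<le> freq_weight m * (freq_weight m * norm (?f m) + \<bar>lam\<bar> * norm (?c m))"
          by (rule mult_left_mono) simp
        thus "freq_weight m ^ 1 * norm (- \<i> * (of_real (freq_sq m) * ?f m + of_real lam * ?c m))
            \<le> freq_weight m ^ 2 * norm (?f m) + \<bar>lam\<bar> * (freq_weight m ^ 1 * norm (?c m))"
          by (simp add: power2_eq_square algebra_simps)
      qed
      also have "\<dots> = (\<Sum>m\<in>F. freq_weight m ^ 2 * norm (?f m)) + \<bar>lam\<bar> * (\<Sum>m\<in>F. freq_weight m ^ 1 * norm (?c m))"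
        by (simp only: sum.distrib sum_distrib_left)
      also have "\<dots> \<le> R + \<bar>lam\<bar> * R ^ 3"
        by (intro add_mono mult_left_mono order_trans[OF finite_sum_le_wiener_norm[OF wiener_pathD[OF u \<tau>] F] R[OF \<tau>]]
            order_trans[OF finite_sum_le_wiener_norm[OF c(1) F] c3]) simp
      finally show "(\<Sum>m\<in>F. freq_weight m ^ 1 * norm (- \<i> * (of_real (freq_sq m) * ?f m + of_real lam * ?c m)))
          \<le> R + \<bar>lam\<bar> * R ^ 3" .
    qed auto
    thus "(\<Sum>m\<in>F. freq_weight m ^ 1 * norm (fourier_coeff (\<lambda>x. u t x - u a x) m)) \<le> (t - a) * (R + \<bar>lam\<bar> * R ^ 3)"
      by (simp only: fourier_coeff_diff[OF wiener_spaceD(2)[OF ut] wiener_spaceD(2)[OF ua]])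
  qed
qed

section \<open>Lipschitz continuity of the energy\<close>

lemma abs_power2_norm_diff_le:
  fixes z w :: complex
  assumes "norm z \<le> B" "norm w \<le> B" "norm (z - w) \<le> E"
  shows "\<bar>(norm z)\<^sup>2 - (norm w)\<^sup>2\<bar> \<le> E * (2 * B)"
proof -
  have "\<bar>(norm z)\<^sup>2 - (norm w)\<^sup>2\<bar> = \<bar>norm z - norm w\<bar> * (norm z + norm w)"
    by (simp add: power2_eq_square square_diff_square_factored abs_mult mult.commute)
  also have "\<dots> \<le> E * (2 * B)"
    using assms norm_triangle_ineq3[of z w] order_trans[OF norm_ge_zero assms(3)]
    by (intro mult_mono) auto
  finally show ?thesis .
qed

text \<open>
  The norm with \<open>r = 1\<close> bounds the function and all its first derivatives uniformly, so the energy
  density is Lipschitz pointwise.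
\<close>

lemma hamiltonian_lipschitz:
  fixes v u :: "real ^ 'd \<Rightarrow> complex"
  assumes v: "v \<in> wiener_space 1" and u: "u \<in> wiener_space 1"
    and Bv: "wiener_norm 1 v \<le> B" and Bu: "wiener_norm 1 u \<le> B"
    and E: "wiener_norm 1 (\<lambda>x. v x - u x) \<le> E"
  shows "\<bar>hamiltonian lam v - hamiltonian lam u\<bar> \<le> (2 * real CARD('d) * B + 2 * \<bar>lam\<bar> * B ^ 3) * E"
proof -
  define density where "density w x = (\<Sum>i\<in>UNIV. (cmod (partial_deriv i w x))\<^sup>2) + lam / 2 * (cmod (w x)) ^ 4"
    for w :: "real ^ 'd \<Rightarrow> complex" and x
  have cont: "continuous_on UNIV (density w)" if w: "w \<in> wiener_space 1" for w :: "real ^ 'd \<Rightarrow> complex"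
    unfolding density_def[abs_def]
    using wiener_spaceD(2)[OF w] wiener_spaceD(2)[OF partial_deriv_wiener_space(2)[OF w[unfolded One_nat_def]]]
    by (intro continuous_intros)
  note d = wiener_space_diff(1)[OF v u]
  have pd: "norm (partial_deriv i w x) \<le> wiener_norm 1 w" if w: "w \<in> wiener_space 1" for w :: "real ^ 'd \<Rightarrow> complex" and i x
    using norm_le_wiener_norm[OF partial_deriv_wiener_space(2)[OF w[unfolded One_nat_def]], of i x]
      partial_deriv_wiener_space(3)[OF w[unfolded One_nat_def], of i] by simp
  have "norm (torus_mean (\<lambda>x. density v x - density u x)) \<le> (2 * real CARD('d) * B + 2 * \<bar>lam\<bar> * B ^ 3) * E"
  proof (rule norm_torus_mean_le)
    show "continuous_on UNIV (\<lambda>x. density v x - density u x)"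
      by (intro continuous_intros cont v u)
    fix x
    have grad: "\<bar>\<Sum>i\<in>UNIV. (cmod (partial_deriv i v x))\<^sup>2 - (cmod (partial_deriv i u x))\<^sup>2\<bar> \<le> (\<Sum>i\<in>(UNIV :: 'd set). E * (2 * B))"
    proof (rule order_trans[OF sum_abs sum_mono])
      fix i
      have "norm (partial_deriv i v x - partial_deriv i u x) \<le> E"
        using pd[OF d, of i x] E partial_deriv_diff[OF v[unfolded One_nat_def] u[unfolded One_nat_def], of i x] by simp
      thus "\<bar>(cmod (partial_deriv i v x))\<^sup>2 - (cmod (partial_deriv i u x))\<^sup>2\<bar> \<le> E * (2 * B)"
        using pd[OF v, of i x] pd[OF u, of i x] Bv Bu by (intro abs_power2_norm_diff_le) auto
    qed
    have vx: "norm (v x) \<le> B" and ux: "norm (u x) \<le> B" and ex: "norm (v x - u x) \<le> E"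
      using norm_le_wiener_norm[OF v, of x] norm_le_wiener_norm[OF u, of x] norm_le_wiener_norm[OF d, of x] Bv Bu E by auto
    have "\<bar>(cmod (v x)) ^ 4 - (cmod (u x)) ^ 4\<bar>
        = \<bar>(cmod (v x))\<^sup>2 - (cmod (u x))\<^sup>2\<bar> * ((cmod (v x))\<^sup>2 + (cmod (u x))\<^sup>2)"
    proof -
      have "(cmod (v x)) ^ 4 - (cmod (u x)) ^ 4 = ((cmod (v x))\<^sup>2 - (cmod (u x))\<^sup>2) * ((cmod (v x))\<^sup>2 + (cmod (u x))\<^sup>2)"
        by (simp add: power4_eq_xxxx power2_eq_square algebra_simps)
      thus ?thesis by (simp add: abs_mult)
    qed
    also have "\<dots> \<le> (E * (2 * B)) * (B\<^sup>2 + B\<^sup>2)"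
      using order_trans[OF norm_ge_zero vx] order_trans[OF norm_ge_zero ex]
      by (intro mult_mono abs_power2_norm_diff_le add_mono power_mono vx ux ex) auto
    finally have "\<bar>lam\<bar> / 2 * \<bar>(cmod (v x)) ^ 4 - (cmod (u x)) ^ 4\<bar> \<le> \<bar>lam\<bar> / 2 * ((E * (2 * B)) * (B\<^sup>2 + B\<^sup>2))"
      by (rule mult_left_mono) simp
    hence "\<bar>lam / 2 * ((cmod (v x)) ^ 4 - (cmod (u x)) ^ 4)\<bar> \<le> \<bar>lam\<bar> / 2 * ((E * (2 * B)) * (B\<^sup>2 + B\<^sup>2))"
      by (simp only: abs_mult abs_divide abs_numeral)
    also have "\<dots> = 2 * \<bar>lam\<bar> * B ^ 3 * E" by (simp add: power2_eq_square power3_eq_cube)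
    finally have quartic: "\<bar>lam / 2 * ((cmod (v x)) ^ 4 - (cmod (u x)) ^ 4)\<bar> \<le> 2 * \<bar>lam\<bar> * B ^ 3 * E" .
    have "density v x - density u x = (\<Sum>i\<in>UNIV. (cmod (partial_deriv i v x))\<^sup>2 - (cmod (partial_deriv i u x))\<^sup>2)
        + lam / 2 * ((cmod (v x)) ^ 4 - (cmod (u x)) ^ 4)"
      by (simp add: density_def sum_subtractf algebra_simps)
    thus "norm (density v x - density u x) \<le> (2 * real CARD('d) * B + 2 * \<bar>lam\<bar> * B ^ 3) * E"
      using grad quartic by (simp add: algebra_simps)
  qed
  thus ?thesis
    unfolding torus_mean_diff[OF cont[OF v] cont[OF u]] by (simp add: hamiltonian_def density_def[abs_def])
qed

section \<open>The energy error of the iterates\<close>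

lemma schroedinger_solution_subset:
  assumes "schroedinger_solution s lam J p w" "I \<subseteq> J"
  shows "schroedinger_solution s lam I p w"
  using assms unfolding schroedinger_solution_def continuous_into_sobolev_def
  by (meson has_vector_derivative_within_subset subsetD tendsto_within_subset)

lemma schroedinger_solution_wiener_path:
  fixes w :: "real \<Rightarrow> real ^ 'd \<Rightarrow> complex"
  assumes s: "s \<ge> real CARD('d) + 4" and w: "schroedinger_solution s lam I p w"
  shows "wiener_path I w"
  using w unfolding schroedinger_solution_def C2_function_def C1_function_def
  by (intro wiener_path_of_sobolev[OF s]) auto

text \<open>
  The threshold on \<open>h\<close> depends on \<open>\<lambda>\<close> and the bound \<open>R\<close> for \<open>u\<close> only, so the same one serves all iterates; the
  constant in front of \<open>h\<^sup>k\<^sup>+\<^sup>1\<close> depends geometrically on \<open>k\<close>.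
\<close>

lemma iterated_linearisation_error:
  fixes u :: "real \<Rightarrow> real ^ 'd \<Rightarrow> complex"
  assumes s: "s \<ge> real CARD('d) + 4"
    and nls: "schroedinger_solution s lam {tn..tn + h} u u"
    and it: "iterated_linearisation s lam u tn h v" and h: "h > 0"
    and R: "\<And>t. t \<in> {tn..tn + h} \<Longrightarrow> wiener_norm 2 (u t) \<le> R"
    and small: "h * (8 * \<bar>lam\<bar> * R\<^sup>2) \<le> 1"
  shows "wiener_path {tn..tn + h} (v k)"
    and "t \<in> {tn..tn + h} \<Longrightarrow> wiener_norm 1 (v k t) \<le> 2 * R"
    and "t \<in> {tn..tn + h} \<Longrightarrow>
      wiener_norm 1 (\<lambda>x. v k t x - u t x) \<le> (R + \<bar>lam\<bar> * R ^ 3) * (6 * \<bar>lam\<bar> * R\<^sup>2) ^ k * h ^ (k + 1)"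
proof -
  let ?I = "{tn..tn + h}"
  have tn: "tn \<in> ?I" using h by simp
  have R0: "R \<ge> 0" using R[OF tn] wiener_norm_nonneg[of 2 "u tn"] by linarith
  have v0: "v 0 t = u tn" if "t \<in> ?I" for t
    using it that by (simp add: iterated_linearisation_def)
  have sol: "schroedinger_solution s lam ?I (v j) (v (Suc j))" and init: "v (Suc j) tn = u tn" for j
    using it by (auto simp: iterated_linearisation_def)
  have u: "wiener_path ?I u" by (rule schroedinger_solution_wiener_path[OF s nls])
  have R1: "wiener_norm 1 (u t) \<le> R" if "t \<in> ?I" for t
    using wiener_space_mono(2)[OF wiener_pathD[OF u that], of 1] R[OF that] by simp
  have "wiener_path ?I (v 0)"
    by (rule wiener_path_const[OF wiener_pathD[OF u tn]]) (rule v0)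
  hence path: "wiener_path ?I (v j)" for j
    using schroedinger_solution_wiener_path[OF s sol] by (cases j) auto
  have small': "(tn + h - tn) * (\<bar>lam\<bar> * (2 * R)\<^sup>2) \<le> 1 / 2"
    using small by (simp add: power_mult_distrib algebra_simps)
  have bound: "wiener_norm 1 (v j t) \<le> 2 * R" if "t \<in> ?I" for j t
    using that
  proof (induction j arbitrary: t)
    case 0
    thus ?case using v0[OF 0] R1[OF tn] R0 by simp
  next
    case (Suc j)
    have "wiener_norm 1 (v (Suc j) t) \<le> 2 * wiener_norm 1 (v (Suc j) tn)"
      by (rule linear_solution_bound[OF sol path path Suc.IH small' Suc.prems])
    thus ?case using R1[OF tn] by (simp add: init)
  qed
  have err: "wiener_norm 1 (\<lambda>x. v j t x - u t x) \<le> (R + \<bar>lam\<bar> * R ^ 3) * (6 * \<bar>lam\<bar> * R\<^sup>2) ^ j * h ^ (j + 1)"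
    if "t \<in> ?I" for j t
    using that
  proof (induction j arbitrary: t)
    case 0
    note diff = wiener_space_diff(1)[OF wiener_path_1[OF u 0] wiener_path_1[OF u tn]]
    have "wiener_norm 1 (\<lambda>x. u tn x - u t x) \<le> wiener_norm 1 (\<lambda>x. u t x - u tn x)"
      using wiener_space_cmult(2)[OF diff, of "-1"] by simp
    also have "\<dots> \<le> (t - tn) * (R + \<bar>lam\<bar> * R ^ 3)"
      by (rule nls_increment_bound[OF nls u R 0])
    also have "\<dots> \<le> h * (R + \<bar>lam\<bar> * R ^ 3)"
      using 0 R0 by (intro mult_right_mono) auto
    finally show ?case using v0[OF 0] by (simp add: mult.commute)
  next
    case (Suc j)
    have "wiener_norm 1 (\<lambda>x. v (Suc j) t x - u t x) \<le> (tn + h - tn) * (6 * \<bar>lam\<bar> * R\<^sup>2) *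
        ((R + \<bar>lam\<bar> * R ^ 3) * (6 * \<bar>lam\<bar> * R\<^sup>2) ^ j * h ^ (j + 1))"
      by (rule linearisation_error_step[OF sol nls init path path u bound R1 Suc.IH small' Suc.prems])
    thus ?case by (simp add: mult_ac)
  qed
  show "wiener_path ?I (v k)" by (rule path)
  show "t \<in> ?I \<Longrightarrow> wiener_norm 1 (v k t) \<le> 2 * R" by (rule bound)
  show "t \<in> ?I \<Longrightarrow> wiener_norm 1 (\<lambda>x. v k t x - u t x)
      \<le> (R + \<bar>lam\<bar> * R ^ 3) * (6 * \<bar>lam\<bar> * R\<^sup>2) ^ k * h ^ (k + 1)" by (rule err)
qed

theorem theorem6:
  "\<exists>s0::real. \<forall>s\<ge>s0. \<forall>(lam::real) (T::real) (u :: real \<Rightarrow> real ^ 'd \<Rightarrow> complex).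
     0 < T \<and> nls_solution s lam {0..T} u \<longrightarrow>
     (\<forall>k::nat. k \<ge> 1 \<longrightarrow>
       (\<exists>C h0. h0 > 0 \<and>
         (\<forall>h tn v. 0 < h \<and> h \<le> h0 \<and> 0 \<le> tn \<and> tn + h \<le> T
              \<and> iterated_linearisation s lam u tn h v \<longrightarrow>
            (\<forall>t\<in>{tn..tn + h}.
               \<bar>hamiltonian lam (v k t) - hamiltonian lam (u t)\<bar> \<le> C * h ^ (k + 1)))))"
proof (rule exI[of _ "real CARD('d) + 4"], intro allI impI)
  fix s lam T :: real and u :: "real \<Rightarrow> real ^ 'd \<Rightarrow> complex" and k :: nat
  assume s: "real CARD('d) + 4 \<le> s" and asm: "0 < T \<and> nls_solution s lam {0..T} u"
    and "1 \<le> k"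
  from asm have nls: "schroedinger_solution s lam {0..T} u u" by (simp add: nls_solution_def)
  note u = schroedinger_solution_wiener_path[OF s nls]
  have "\<exists>t'\<in>{0..T}. \<forall>t\<in>{0..T}. wiener_norm 2 (u t) \<le> wiener_norm 2 (u t')"
    using asm by (intro continuous_attains_sup wiener_path_continuous_norm[OF u]) auto
  then obtain R where R: "\<And>t. t \<in> {0..T} \<Longrightarrow> wiener_norm 2 (u t) \<le> R" and R0: "R \<ge> 0"
    using wiener_norm_nonneg by blast
  define L where "L = 2 * real CARD('d) * (2 * R) + 2 * \<bar>lam\<bar> * (2 * R) ^ 3"
  define K where "K = (R + \<bar>lam\<bar> * R ^ 3) * (6 * \<bar>lam\<bar> * R\<^sup>2) ^ k"
  \<comment> \<open>\<open>h |\<lambda>| (2 R)\<^sup>2 \<le> 1/2\<close> is what stability requires; the summand \<open>1\<close> covers \<open>\<lambda> = 0\<close> and \<open>R = 0\<close>\<close>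
  define h0 where "h0 = 1 / (8 * \<bar>lam\<bar> * R\<^sup>2 + 1)"
  have h0: "h0 > 0" by (simp add: h0_def add_nonneg_pos)
  show "\<exists>C h0. h0 > 0 \<and>
         (\<forall>h tn v. 0 < h \<and> h \<le> h0 \<and> 0 \<le> tn \<and> tn + h \<le> T
              \<and> iterated_linearisation s lam u tn h v \<longrightarrow>
            (\<forall>t\<in>{tn..tn + h}.
               \<bar>hamiltonian lam (v k t) - hamiltonian lam (u t)\<bar> \<le> C * h ^ (k + 1)))"
  proof (rule exI[of _ "L * K"], rule exI[of _ h0], intro conjI allI impI ballI h0)
    fix h tn v t
    assume A: "0 < h \<and> h \<le> h0 \<and> 0 \<le> tn \<and> tn + h \<le> T \<and> iterated_linearisation s lam u tn h v"
      and t: "t \<in> {tn..tn + h}"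
    have sub: "{tn..tn + h} \<subseteq> {0..T}" using A by auto
    have "h * (8 * \<bar>lam\<bar> * R\<^sup>2 + 1) \<le> h0 * (8 * \<bar>lam\<bar> * R\<^sup>2 + 1)"
      using A by (intro mult_right_mono) auto
    also have "\<dots> = 1"
    proof -
      have "8 * \<bar>lam\<bar> * R\<^sup>2 + 1 > 0" by (simp add: add_nonneg_pos)
      thus ?thesis by (simp add: h0_def)
    qed
    finally have small: "h * (8 * \<bar>lam\<bar> * R\<^sup>2) \<le> 1" using A by (simp add: algebra_simps)
    have RI: "wiener_norm 2 (u t) \<le> R" if "t \<in> {tn..tn + h}" for t using R sub that by blast
    have it: "iterated_linearisation s lam u tn h v" and h: "h > 0" using A by auto
    note err = iterated_linearisation_error[OF s schroedinger_solution_subset[OF nls sub] it h]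
    have vk: "v k t \<in> wiener_space 1"
      by (rule wiener_path_1[OF err(1)[OF _ small] t]) (rule RI)
    have vR: "wiener_norm 1 (v k t) \<le> 2 * R"
      by (rule err(2)[OF _ small t]) (rule RI)
    have E: "wiener_norm 1 (\<lambda>x. v k t x - u t x) \<le> K * h ^ (k + 1)"
      unfolding K_def by (rule err(3)[OF _ small t]) (rule RI)
    have t0: "t \<in> {0..T}" using t sub by blast
    have u1: "wiener_norm 1 (u t) \<le> 2 * R"
      using wiener_space_mono(2)[OF wiener_pathD[OF u t0], of 1] R[OF t0] R0 by simp
    have "\<bar>hamiltonian lam (v k t) - hamiltonian lam (u t)\<bar> \<le> L * (K * h ^ (k + 1))"
      unfolding L_def by (rule hamiltonian_lipschitz[OF vk wiener_path_1[OF u t0] vR u1 E])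
    thus "\<bar>hamiltonian lam (v k t) - hamiltonian lam (u t)\<bar> \<le> L * K * h ^ (k + 1)"
      by (simp add: mult_ac)
  qed
qed

end
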